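(* For a radial weight $\nu$ and $n\in\mathbb{N}$, define $$\mu^n_\nu(z)=2^n\int_{|z|}^1r_1\left(\int_{r_1}^1r_2\cdots\int_{r_{n-2}}^1r_{n-1}\left(\int_{r_{n-1}}^1\frac{\nu(r)}{r^{2n-1}}\,dr\right)dr_{n-1}\cdots dr_2\right)dr_1=\sum_{j=1}^nC_{j,n}|z|^{2j-2}\int_{|z|}^1\frac{\nu(t)}{t^{2j-1}}\,dt,\quad z\in\mathbb{D},$$ (for $n=1$, $\mu^1_\nu(z)=2\int_{|z|}^1\frac{\nu(r)}{r}\,dr$), where the real constants $C_{j,n}$ are uniquely determined by the identity $$\sum_{j=1}^n\frac{C_{j,n}}{k+j}=\frac{2}{(k+1)\cdots(k+n)},\quad k\in\mathbb{N}.$$ Then $$\int_{\mathbb{D}}f(\zeta)\overline{B_z^{\mu^n_\nu}(\zeta)}\,\nu(\zeta)\,dA(\zeta)=\frac{d^n}{dz^n}\left(z^nf(z)\right),\quad f\in A^1_\nu.$$ Moreover, if $\nu\in\widehat{\mathcal{D}}$, then $$\mu^n_\nu(z)\asymp\widehat{\nu}(z)(1-|z|)^{n-1},\quad z\in\mathbb{D},$$ and $$\widehat{\mu^n_\nu}(z)\asymp\widehat{\nu}(z)(1-|z|)^n,\quad z\in\mathbb{D}.$$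
   Context: $\mathbb{D}$ is the open unit disc in $\mathbb{C}$ and $dA=\frac{dx\,dy}{\pi}$ is the normalized area measure. A radial weight is a non-negative $\omega\in L^1(\mathbb{D})$ with $\omega(z)=\omega(|z|)$ for all $z\in\mathbb{D}$. Write $\widehat{\omega}(z)=\int_{|z|}^1\omega(s)\,ds$; all radial weights are assumed to satisfy $\widehat{\omega}(z)>0$ for all $z\in\mathbb{D}$. $A^p_\omega$ is the space of analytic $f$ on $\mathbb{D}$ with $\int_{\mathbb{D}}|f|^p\omega\,dA<\infty$. $B^\omega_z$ denotes the reproducing kernel at $z\in\mathbb{D}$ of the Hilbert space $A^2_\omega$, with inner product $\int_{\mathbb{D}}f\overline{g}\,\omega\,dA$. A radial weight $\omega$ belongs to $\widehat{\mathcal{D}}$ if there is a constant $C=C(\omega)\ge1$ with $\widehat{\omega}(r)\le C\,\widehat{\omega}(\frac{1+r}{2})$ for all $0\le r<1$. $a\asymp b$ means $C^{-1}a\le b\le Ca$ with a constant $C>0$ independent of $z$ (it may depend on $\nu$ and $n$).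
   Formalization: The estimate μ ≍ ν̂(1−|z|)^{n−1} on all of D fails near 0 (ν=1, n=1: μ=2log(1/|z|)). It is proved for r₀≤|z|<1 with constant depending on r₀, as a lower bound for z≠0, and on all of D when ∫₀¹ν(r)/r dr<∞. *)

theory Defs
  imports "HOL-Analysis.Analysis"
begin

abbreviation unit_disc :: "complex set" where
  "unit_disc \<equiv> ball 0 1"

definition disc_area :: "complex measure" where
  "disc_area = density (lebesgue_on unit_disc) (\<lambda>_. ennreal (1 / pi))"

text \<open>
  The tail integral is extended-valued: a radial function that is integrable on the disc need not
  be integrable on the interval \<open>(0,1)\<close>, so the value at the origin may be infinite.
\<close>

definition tail :: "(complex \<Rightarrow> real) \<Rightarrow> complex \<Rightarrow> ennreal" where
  "tail \<omega> z = (\<integral>\<^sup>+ s\<in>{norm z..<1}. ennreal (\<omega> (complex_of_real s)) \<partial>lebesgue)"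

definition radial_weight :: "(complex \<Rightarrow> real) \<Rightarrow> bool" where
  "radial_weight \<omega> \<longleftrightarrow>
     (\<forall>z\<in>unit_disc. 0 \<le> \<omega> z) \<and>
     (\<forall>z\<in>unit_disc. \<omega> z = \<omega> (complex_of_real (norm z))) \<and>
     integrable disc_area \<omega> \<and>
     (\<forall>z\<in>unit_disc. 0 < tail \<omega> z)"

definition doubling_weight :: "(complex \<Rightarrow> real) \<Rightarrow> bool" where
  "doubling_weight \<omega> \<longleftrightarrow> radial_weight \<omega> \<and>
     (\<exists>C::real. 1 \<le> C \<and>
        (\<forall>r::real. 0 \<le> r \<and> r < 1 \<longrightarrow>
           tail \<omega> (complex_of_real r) \<le> ennreal C * tail \<omega> (complex_of_real ((1 + r) / 2))))"

definition bergman_space :: "real \<Rightarrow> (complex \<Rightarrow> real) \<Rightarrow> (complex \<Rightarrow> complex) set" where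
  "bergman_space p \<omega> =
     {f. f holomorphic_on unit_disc \<and> integrable disc_area (\<lambda>z. norm (f z) powr p * \<omega> z)}"

text \<open>
  Functions are total, so a reproducing kernel is determined on the disc only; its values
  elsewhere are irrelevant, as the area measure lives on the disc.
\<close>

definition is_reproducing_kernel ::
    "(complex \<Rightarrow> real) \<Rightarrow> complex \<Rightarrow> (complex \<Rightarrow> complex) \<Rightarrow> bool" where
  "is_reproducing_kernel \<omega> z K \<longleftrightarrow>
     K \<in> bergman_space 2 \<omega> \<and>
     (\<forall>f\<in>bergman_space 2 \<omega>.
        f z = (LINT \<zeta>|disc_area. f \<zeta> * cnj (K \<zeta>) * complex_of_real (\<omega> \<zeta>)))"

definition bergman_kernel :: "(complex \<Rightarrow> real) \<Rightarrow> complex \<Rightarrow> complex \<Rightarrow> complex" where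
  "bergman_kernel \<omega> z = (SOME K. is_reproducing_kernel \<omega> z K)"

text \<open>
  \<open>nested g m s\<close> is the iterated integral of \<open>g\<close> over \<open>s \<le> r\<^sub>1 \<le> \<dots> \<le> r\<^sub>m \<le> r < 1\<close>
  with the factor \<open>r\<^sub>1 \<cdots> r\<^sub>m\<close>.
\<close>

primrec nested :: "(real \<Rightarrow> real) \<Rightarrow> nat \<Rightarrow> real \<Rightarrow> real" where
  "nested g 0 s = (LINT r:{s..<1}|lebesgue. g r)"
| "nested g (Suc m) s = (LINT r:{s..<1}|lebesgue. r * nested g m r)"

text \<open>
  At the origin the defining integral may diverge to infinity; the real-valued integral is then 0.
\<close>

definition mu_weight :: "nat \<Rightarrow> (complex \<Rightarrow> real) \<Rightarrow> complex \<Rightarrow> real" where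
  "mu_weight n \<nu> z =
     2 ^ n * nested (\<lambda>r. \<nu> (complex_of_real r) / r ^ (2 * n - 1)) (n - 1) (norm z)"

definition coeff_identity :: "nat \<Rightarrow> (nat \<Rightarrow> real) \<Rightarrow> nat \<Rightarrow> bool" where
  "coeff_identity n C k \<longleftrightarrow>
     (\<Sum>j=1..n. C j / (real k + real j)) = 2 / (\<Prod>j=1..n. (real k + real j))"

definition comparable_on ::
    "complex set \<Rightarrow> (complex \<Rightarrow> ennreal) \<Rightarrow> (complex \<Rightarrow> ennreal) \<Rightarrow> bool" where
  "comparable_on S a b \<longleftrightarrow>
     (\<exists>C::real. 0 < C \<and> (\<forall>z\<in>S. ennreal (1 / C) * a z \<le> b z \<and> b z \<le> ennreal C * a z))"

end

theory Submission
  imports Defs "HOL-Complex_Analysis.Complex_Analysis"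
begin

text \<open>
  The kernel identity is a statement about power series. For a radial weight \<open>\<omega>\<close> the monomials are
  orthogonal, so the area integral of \<open>f \<cdot> cnj (\<zeta>^k) \<cdot> \<omega>\<close> picks out the \<open>k\<close>-th Taylor coefficient of
  \<open>f\<close> times the moment \<open>M\<^sub>k(\<omega>)\<close>, the integral of \<open>|\<zeta>|^(2k) \<cdot> \<omega>\<close>. Consequently the kernel of the
  Bergman space of \<open>\<omega>\<close> at \<open>z\<close> must be \<open>\<Sum>k. cnj z^k \<zeta>^k / M\<^sub>k(\<omega>)\<close>. Its coefficients are absolutely
  summable, because the moments of a weight that charges every neighbourhood of the boundary decay
  slower than every geometric sequence. If the kernel of \<open>\<mu> = mu_weight n \<nu>\<close> is integrated against
  \<open>f \<nu>\<close> instead, the \<open>k\<close>-th term of the power series of \<open>f\<close> is therefore multiplied by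
  \<open>M\<^sub>k(\<nu>) / M\<^sub>k(\<mu>)\<close>. This ratio is \<open>(k + 1) \<cdots> (k + n)\<close> (lemma \<open>moment_mu_weight\<close>), which is exactly
  what the operator \<open>f \<mapsto> (z^n f)^(n)\<close> does to \<open>a z^k\<close>.

  Everything about \<open>\<mu>\<close> rests on collapsing the iterated integral by Tonelli's theorem into
  \<open>\<mu>(s) = 2 / (n-1)! \<cdot> \<integral>\<^sub>s\<^sup>1 g(t) (t\<^sup>2 - s\<^sup>2)^(n-1) / t^(2n-1) dt\<close>, where \<open>g\<close> is the profile of \<open>\<nu>\<close> on
  the unit interval. Expanding the power gives the formula with the constants \<open>C\<^sub>j\<close>; their defining
  identity is the partial fraction decomposition of \<open>1 / ((x + 1) \<cdots> (x + n))\<close>, and that same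
  decomposition evaluates the beta integral behind the moments. The two-sided estimates follow from
  \<open>(1 - s) / 2 \<cdot> t \<le> t\<^sup>2 - s\<^sup>2 \<le> 2 (1 - s)\<close>, the left half for \<open>t \<ge> (1 + s) / 2\<close>, where the
  doubling condition says that \<open>\<nu>\<close> still has a fixed proportion of its mass on \<open>[s, 1)\<close>.

  The remaining work is measure-theoretic: a radial function that is Lebesgue measurable on the disc
  has a Lebesgue measurable profile, and the area measure is invariant under rotations with radial
  part \<open>2 r dr\<close>.
\<close>

section \<open>Rotation invariance of the area measure\<close>

lemma nn_integral_lborel_translate:
  fixes a :: "'a::euclidean_space" and f :: "'a \<Rightarrow> ennreal"
  assumes [measurable]: "f \<in> borel_measurable borel"
  shows "(\<integral>\<^sup>+x. f (a + x) \<partial>lborel) = (\<integral>\<^sup>+x. f x \<partial>lborel)"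
proof -
  have "(\<integral>\<^sup>+x. f x \<partial>lborel) = (\<integral>\<^sup>+x. f x \<partial>distr lborel borel ((+) a))"
    by (simp only: lborel_distr_plus)
  also have "\<dots> = (\<integral>\<^sup>+x. f (a + x) \<partial>lborel)"
    by (subst nn_integral_distr) auto
  finally show ?thesis by simp
qed

text \<open>
  The usual proof that a translation invariant measure is unique up to a factor. Integrating
  \<open>1\<^sub>A(c x) 1\<^sub>B(y - c x)\<close> over the plane in \<open>x\<close> and \<open>y\<close>, with \<open>B\<close> the unit disc, gives
  \<open>|B| \<cdot> |c\<inverse> A|\<close> in one order of integration. In the other order, after translating \<open>x\<close> by
  \<open>y / c\<close>, it gives \<open>|B| \<cdot> |A|\<close>, because \<open>B\<close> is invariant under \<open>x \<mapsto> - c x\<close>. Finally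
  \<open>0 < |B| < \<infinity>\<close> can be cancelled.
\<close>

lemma emeasure_lborel_rotate:
  fixes c :: complex
  assumes c: "cmod c = 1" and [measurable]: "A \<in> sets borel"
  shows "emeasure lborel ((*) c -` A) = emeasure lborel A"
proof -
  define B :: "complex set" where "B = ball 0 1"
  have [measurable]: "B \<in> sets borel" by (simp add: B_def)
  have [measurable]: "(*) c \<in> borel_measurable borel" by simp
  have [measurable]: "(*) c -` A \<in> sets borel"
    using measurable_sets[of "(*) c" borel borel A] by simp
  have "c \<noteq> 0" using c by auto
  have B: "indicator B (- c * x) = (indicator B x :: ennreal)" for x
    using c by (simp add: B_def indicator_def norm_mult)
  have "emeasure lborel B * emeasure lborel ((*) c -` A) =
      (\<integral>\<^sup>+x. indicator A (c * x) * (\<integral>\<^sup>+y. indicator B (- c * x + y) \<partial>lborel) \<partial>lborel)"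
  proof -
    have "(\<integral>\<^sup>+x. indicator A (c * x) * emeasure lborel B \<partial>lborel)
        = (\<integral>\<^sup>+x. emeasure lborel B * indicator ((*) c -` A) x \<partial>lborel)"
      by (intro nn_integral_cong) (auto split: split_indicator)
    also have "\<dots> = emeasure lborel B * emeasure lborel ((*) c -` A)"
      by (rule nn_integral_cmult_indicator) simp
    finally show ?thesis
      by (subst nn_integral_lborel_translate) auto
  qed
  also have "\<dots> = (\<integral>\<^sup>+x. (\<integral>\<^sup>+y. indicator A (c * x) * indicator B (- c * x + y) \<partial>lborel) \<partial>lborel)"
    by (intro nn_integral_cong nn_integral_cmult[symmetric]) auto
  also have "\<dots> = (\<integral>\<^sup>+y. (\<integral>\<^sup>+x. indicator A (c * x) * indicator B (- c * x + y) \<partial>lborel) \<partial>lborel)"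
    by (rule lborel_pair.Fubini'[symmetric]) auto
  also have "\<dots> = (\<integral>\<^sup>+y. (\<integral>\<^sup>+x. indicator A (c * (y / c + x)) * indicator B (- c * (y / c + x) + y) \<partial>lborel) \<partial>lborel)"
    by (intro nn_integral_cong nn_integral_lborel_translate[symmetric]) auto
  also have "\<dots> = (\<integral>\<^sup>+y. (\<integral>\<^sup>+x. indicator B x * indicator A (c * x + y) \<partial>lborel) \<partial>lborel)"
  proof (intro nn_integral_cong)
    fix x y :: complex
    have 1: "c * (y / c + x) = c * x + y" using \<open>c \<noteq> 0\<close> by (simp add: field_simps)
    have 2: "- c * (y / c + x) + y = - c * x" using \<open>c \<noteq> 0\<close> by (simp add: field_simps)
    show "indicator A (c * (y / c + x)) * indicator B (- c * (y / c + x) + y) =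
       indicator B x * (indicator A (c * x + y) :: ennreal)"
      unfolding 1 2 B by (simp add: mult.commute)
  qed
  also have "\<dots> = (\<integral>\<^sup>+x. (\<integral>\<^sup>+y. indicator B x * indicator A (c * x + y) \<partial>lborel) \<partial>lborel)"
    by (rule lborel_pair.Fubini') auto
  also have "\<dots> = (\<integral>\<^sup>+x. indicator B x * (\<integral>\<^sup>+y. indicator A (c * x + y) \<partial>lborel) \<partial>lborel)"
    by (intro nn_integral_cong nn_integral_cmult) auto
  also have "\<dots> = emeasure lborel B * emeasure lborel A"
    by (subst nn_integral_lborel_translate) (auto simp: nn_integral_multc)
  finally have "emeasure lborel B * emeasure lborel ((*) c -` A) = emeasure lborel B * emeasure lborel A" .
  moreover have "emeasure lborel B = ennreal pi"
    unfolding B_def by (subst emeasure_ball) (auto simp: unit_ball_vol_2)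
  ultimately show ?thesis
    by (simp add: ennreal_mult_cancel_left)
qed

lemma lborel_distr_rotate:
  fixes c :: complex
  assumes "cmod c = 1"
  shows "distr lborel lborel ((*) c) = lborel"
  by (rule measure_eqI) (auto simp: emeasure_distr emeasure_lborel_rotate[OF assms])

lemma measurable_lebesgue_rotate:
  fixes c :: complex
  assumes "cmod c = 1"
  shows "(*) c \<in> lebesgue \<rightarrow>\<^sub>M lebesgue"
proof -
  have "(*) c \<in> lebesgue \<rightarrow>\<^sub>M lborel"
    by (intro measurable_completion) simp
  then show ?thesis
    using lborel_distr_rotate[OF assms]
    by (intro completion.measurable_completion2) (auto simp: distr_completion)
qed

lemma lebesgue_distr_rotate:
  fixes c :: complex
  assumes "cmod c = 1"
  shows "distr lebesgue lebesgue ((*) c) = lebesgue"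
proof -
  have m: "(*) c \<in> lebesgue \<rightarrow>\<^sub>M lborel"
    by (intro measurable_completion) simp
  have "distr lebesgue lborel ((*) c) = lborel"
    by (subst distr_completion) (auto simp: lborel_distr_rotate[OF assms])
  then show ?thesis
    using completion.completion_distr_eq[OF m] by simp
qed

lemma space_disc_area [simp]: "space disc_area = unit_disc"
  by (simp add: disc_area_def space_restrict_space)

lemma sets_disc_area: "sets disc_area = sets (lebesgue_on unit_disc)"
  by (simp add: disc_area_def)

lemma measurable_disc_area: "f \<in> measurable disc_area M \<longleftrightarrow> f \<in> measurable (lebesgue_on unit_disc) M"
  by (simp add: disc_area_def)

lemma borel_measurable_disc_areaI:
  "f \<in> measurable borel M \<Longrightarrow> f \<in> measurable disc_area M"
  unfolding measurable_disc_area
  by (intro measurable_restrict_space1 measurable_completion) simp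

lemma emeasure_disc_area:
  assumes "A \<in> sets disc_area"
  shows "emeasure disc_area A = ennreal (1 / pi) * emeasure lebesgue A"
proof -
  have "A \<subseteq> unit_disc" using sets.sets_into_space[OF assms] by simp
  have "emeasure disc_area A = (\<integral>\<^sup>+x. ennreal (1 / pi) * indicator A x \<partial>lebesgue_on unit_disc)"
    using assms unfolding disc_area_def by (subst emeasure_density) auto
  also have "\<dots> = ennreal (1 / pi) * emeasure (lebesgue_on unit_disc) A"
    using assms by (subst nn_integral_cmult_indicator) (auto simp: sets_disc_area)
  also have "emeasure (lebesgue_on unit_disc) A = emeasure lebesgue A"
    using \<open>A \<subseteq> unit_disc\<close> by (intro emeasure_restrict_space) auto
  finally show ?thesis .
qed

lemma sets_disc_area_iff: "A \<in> sets disc_area \<longleftrightarrow> A \<subseteq> unit_disc \<and> A \<in> sets lebesgue"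
  unfolding sets_disc_area by (subst sets_restrict_space_iff) auto

lemma rotate_measurable_disc_area:
  assumes "cmod c = 1"
  shows "(*) c \<in> disc_area \<rightarrow>\<^sub>M disc_area"
proof (rule measurableI)
  fix x assume "x \<in> space disc_area" then show "c * x \<in> space disc_area"
    using assms by (simp add: norm_mult)
next
  fix A assume A: "A \<in> sets disc_area"
  note measurable_lebesgue_rotate[OF assms]
  moreover have "A \<in> sets lebesgue" "A \<subseteq> unit_disc" using A by (auto simp: sets_disc_area_iff)
  ultimately have "(*) c -` A \<in> sets lebesgue"
    using measurable_sets[of "(*) c" lebesgue lebesgue A] by simp
  moreover have "(*) c -` A \<subseteq> unit_disc"
    using \<open>A \<subseteq> unit_disc\<close> assms by (force simp: norm_mult)
  ultimately show "(*) c -` A \<inter> space disc_area \<in> sets disc_area"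
    by (auto simp: sets_disc_area_iff)
qed

lemma disc_area_distr_rotate:
  assumes c: "cmod c = 1"
  shows "distr disc_area disc_area ((*) c) = disc_area"
proof (rule measure_eqI)
  fix A assume "A \<in> sets (distr disc_area disc_area ((*) c))"
  then have A: "A \<in> sets disc_area" by simp
  note m = rotate_measurable_disc_area[OF c]
  have A': "A \<in> sets lebesgue" "A \<subseteq> unit_disc" using A by (auto simp: sets_disc_area_iff)
  have sub: "(*) c -` A \<subseteq> unit_disc"
    using A' c by (force simp: norm_mult)
  note L = measurable_lebesgue_rotate[OF c]
  have "emeasure (distr disc_area disc_area ((*) c)) A = emeasure disc_area ((*) c -` A \<inter> unit_disc)"
    using emeasure_distr[OF m A] by simp
  also have "\<dots> = ennreal (1 / pi) * emeasure lebesgue ((*) c -` A \<inter> unit_disc)"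
    using measurable_sets[OF m A] by (intro emeasure_disc_area) simp
  also have "(*) c -` A \<inter> unit_disc = (*) c -` A \<inter> space lebesgue" using sub by auto
  also have "emeasure lebesgue \<dots> = emeasure (distr lebesgue lebesgue ((*) c)) A"
    using emeasure_distr[OF L A'(1)] by simp
  also have "ennreal (1 / pi) * \<dots> = emeasure disc_area A"
    unfolding lebesgue_distr_rotate[OF c] using emeasure_disc_area[OF A] by simp
  finally show "emeasure (distr disc_area disc_area ((*) c)) A = emeasure disc_area A" .
qed simp

lemma integral_disc_area_rotate:
  fixes f :: "complex \<Rightarrow> complex"
  assumes "cmod c = 1" and "f \<in> borel_measurable disc_area"
  shows "(LINT z|disc_area. f (c * z)) = (LINT z|disc_area. f z)"
  using integral_distr[OF rotate_measurable_disc_area[OF assms(1)] assms(2)]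
  by (simp add: disc_area_distr_rotate[OF assms(1)])

section \<open>Radial functions on the disc\<close>

text \<open>
  Polar coordinates for radial functions: both sides give \<open>{x<..}\<close> the mass \<open>1 - x\<^sup>2\<close> for \<open>x\<close> in the
  unit interval, by the area of a disc on the left and by integration on the right.
\<close>

lemma distr_disc_area_norm:
  "distr disc_area borel norm = density lborel (\<lambda>r. ennreal (2 * r) * indicator {0..<1} r)"
proof (rule measure_eqI_lessThan)
  have nm: "(norm :: complex \<Rightarrow> real) \<in> borel_measurable disc_area"
    by (intro borel_measurable_disc_areaI) simp
  fix x :: real
  define y where "y = max 0 (min x 1)"
  have y: "0 \<le> y" "y \<le> 1" by (auto simp: y_def)
  have "emeasure (distr disc_area borel norm) {x<..} = emeasure disc_area (norm -` {x<..} \<inter> unit_disc)"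
    using emeasure_distr[OF nm, of "{x<..}"] by simp
  also have "\<dots> = ennreal (1 / pi) * emeasure lebesgue (norm -` {x<..} \<inter> unit_disc)"
    using measurable_sets[OF nm, of "{x<..}"] by (intro emeasure_disc_area) simp
  also have "emeasure lebesgue (norm -` {x<..} \<inter> unit_disc) = ennreal (pi * (1 - y\<^sup>2))"
  proof (cases "x < 0")
    case True
    then have "norm -` {x<..} \<inter> unit_disc = unit_disc"
      using less_le_trans[OF True norm_ge_zero] by auto
    moreover have "y = 0" using True by (simp add: y_def)
    ultimately show ?thesis by (simp add: emeasure_ball unit_ball_vol_2)
  next
    case False
    then have "norm -` {x<..} \<inter> unit_disc = ball 0 1 - cball (0::complex) y"
      by (auto simp: y_def min_def)
    then have "emeasure lebesgue (norm -` {x<..} \<inter> unit_disc) = emeasure lborel (ball 0 1 - cball (0::complex) y)"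
      by (simp add: emeasure_completion)
    also have "\<dots> = emeasure lborel (ball 0 1 - ball (0::complex) y)"
    proof -
      have "sphere (0::complex) y \<in> null_sets lborel"
        using negligible_sphere[of "0::complex" y]
        by (auto simp: null_sets_completion_iff negligible_iff_null_sets)
      then have "emeasure lborel ((ball 0 1 - ball (0::complex) y) - sphere 0 y) = emeasure lborel (ball 0 1 - ball (0::complex) y)"
        by (intro emeasure_Diff_null_set) auto
      moreover have "(ball 0 1 - ball (0::complex) y) - sphere 0 y = ball 0 1 - cball (0::complex) y"
        by auto
      ultimately show ?thesis by simp
    qed
    also have "\<dots> = ennreal pi - ennreal (pi * y\<^sup>2)"
      using y by (subst emeasure_Diff) (auto simp: emeasure_ball unit_ball_vol_2)
    also have "\<dots> = ennreal (pi * (1 - y\<^sup>2))"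
      using y by (subst ennreal_minus) (auto simp: algebra_simps)
    finally show ?thesis .
  qed
  also have "ennreal (1 / pi) * ennreal (pi * (1 - y\<^sup>2)) = ennreal (1 - y\<^sup>2)"
    by (subst ennreal_mult'[symmetric]) auto
  finally have 1: "emeasure (distr disc_area borel norm) {x<..} = ennreal (1 - y\<^sup>2)" .
  then show "emeasure (distr disc_area borel norm) {x<..} < \<infinity>" by simp
  have "emeasure (density lborel (\<lambda>r. ennreal (2 * r) * indicator {0..<1} r)) {x<..}
      = (\<integral>\<^sup>+ r. ennreal (2 * r) * indicator {0..<1} r * indicator {x<..} r \<partial>lborel)"
    by (subst emeasure_density) auto
  also have "\<dots> = (\<integral>\<^sup>+ r. ennreal (2 * r) * indicator {y..1} r \<partial>lborel)"
    using AE_lborel_singleton[of "1::real"] AE_lborel_singleton[of x]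
    by (intro nn_integral_cong_AE, eventually_elim) (auto split: split_indicator simp: y_def max_def min_def)
  also have "\<dots> = ennreal (1\<^sup>2 - y\<^sup>2)"
    using y by (intro nn_integral_FTC_Icc[where F="\<lambda>r. r\<^sup>2"]) (auto intro!: derivative_eq_intros)
  finally show "emeasure (distr disc_area borel norm) {x<..} =
      emeasure (density lborel (\<lambda>r. ennreal (2 * r) * indicator {0..<1} r)) {x<..}"
    using 1 by simp
qed auto

lemma nn_integral_disc_area_radial:
  fixes h :: "real \<Rightarrow> ennreal"
  assumes h: "h \<in> borel_measurable borel"
  shows "(\<integral>\<^sup>+z. h (norm z) \<partial>disc_area) = (\<integral>\<^sup>+r\<in>{0..<1}. ennreal (2 * r) * h r \<partial>lborel)"
proof -
  have nm: "(norm :: complex \<Rightarrow> real) \<in> borel_measurable disc_area"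
    by (intro borel_measurable_disc_areaI) simp
  have "(\<integral>\<^sup>+z. h (norm z) \<partial>disc_area) = (\<integral>\<^sup>+r. h r \<partial>distr disc_area borel norm)"
    using h nm by (subst nn_integral_distr) auto
  also have "\<dots> = (\<integral>\<^sup>+r\<in>{0..<1}. ennreal (2 * r) * h r \<partial>lborel)"
    unfolding distr_disc_area_norm using h
    by (subst nn_integral_density) (auto simp: mult_ac)
  finally show ?thesis .
qed

lemma AE_disc_area_norm:
  assumes P: "AE r in lborel. r \<in> {0..<1} \<longrightarrow> P r"
  shows "AE z in disc_area. P (norm z)"
proof -
  have nm: "(norm :: complex \<Rightarrow> real) \<in> borel_measurable disc_area"
    by (intro borel_measurable_disc_areaI) simp
  obtain N where N: "{r \<in> space lborel. \<not> (r \<in> {0..<1} \<longrightarrow> P r)} \<subseteq> N" "N \<in> sets lborel" "emeasure lborel N = 0"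
    using AE_E[OF P] by auto
  have "AE r in distr disc_area borel norm. r \<notin> N"
    unfolding distr_disc_area_norm
    using AE_not_in[of N lborel] N(2,3) by (subst AE_density) (auto simp: null_sets_def)
  then have "AE z in disc_area. norm z \<notin> N"
    using nm N(2) by (subst (asm) AE_distr_iff) auto
  moreover have "AE z in disc_area. z \<in> unit_disc"
    using AE_space[of disc_area] by simp
  ultimately show ?thesis
    by eventually_elim (use N(1) in \<open>simp add: subset_eq, metis norm_ge_zero\<close>)
qed

text \<open>
  The set on the disc contains an \<open>F\<^sub>\<sigma>\<close> set \<open>C\<close> of full measure, and so does its complement, with
  \<open>C'\<close> say. The images of \<open>C\<close> and \<open>C'\<close> under the norm are countable unions of compact sets, hence
  Borel, and they lie in \<open>E\<close> and in its complement. What they leave uncovered in the unit interval is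
  a Borel set \<open>R\<close> whose preimage under the norm is null in the disc; as the radial part of the area
  measure has positive density \<open>2 r\<close>, the set \<open>R\<close> is null itself, and \<open>E\<close> differs from a Borel set
  by a subset of \<open>R\<close>.
\<close>

lemma radial_set_lebesgue:
  fixes E :: "real set"
  assumes E: "E \<subseteq> {0..<1}" and S: "{z \<in> unit_disc. norm z \<in> E} \<in> sets lebesgue"
  shows "E \<in> sets lebesgue"
proof -
  define S where "S = {z \<in> unit_disc. norm z \<in> E}"
  have borel_norm: "norm ` C \<in> sets borel" if fs: "fsigma C" for C :: "complex set"
  proof -
    obtain F :: "nat \<Rightarrow> complex set" where F: "range F \<subseteq> Collect compact" "C = \<Union>(F ` UNIV)"
      using iffD1[OF fsigma_Union_compact fs] by blast
    have "norm ` C = (\<Union>i. norm ` F i)" using F by auto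
    moreover have "norm ` F i \<in> sets borel" for i
    proof -
      have "compact (norm ` F i)"
        using F(1) by (intro compact_continuous_image continuous_on_norm_id) auto
      then show ?thesis by (simp add: borel_compact)
    qed
    ultimately show ?thesis by auto
  qed
  obtain C T where C: "fsigma C" "T \<in> null_sets lebesgue" "C \<union> T = S" "disjnt C T"
    using lebesgue_set_almost_fsigma[of S] S unfolding S_def by metis
  have "unit_disc - S \<in> sets lebesgue" using S unfolding S_def by (intro sets.Diff) auto
  then obtain C' T' where C': "fsigma C'" "T' \<in> null_sets lebesgue" "C' \<union> T' = unit_disc - S" "disjnt C' T'"
    using lebesgue_set_almost_fsigma by metis
  define R where "R = {0..<1} - norm ` C - norm ` C'"
  have R[measurable]: "R \<in> sets borel" unfolding R_def using borel_norm C(1) C'(1) by auto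
  have RT: "norm -` R \<inter> unit_disc \<subseteq> T \<union> T'"
    using C(3) C'(3) by (fastforce simp: R_def)
  have nm: "(norm :: complex \<Rightarrow> real) \<in> borel_measurable disc_area"
    by (intro borel_measurable_disc_areaI) simp
  have "norm -` R \<inter> unit_disc \<in> sets disc_area"
    using measurable_sets[OF nm R] by simp
  then have "emeasure disc_area (norm -` R \<inter> unit_disc) = ennreal (1 / pi) * emeasure lebesgue (norm -` R \<inter> unit_disc)"
    by (rule emeasure_disc_area)
  also have "norm -` R \<inter> unit_disc \<in> null_sets lebesgue"
    using C(2) C'(2) RT
    by (meson completion.complete2 null_sets.Un)
  then have "emeasure lebesgue (norm -` R \<inter> unit_disc) = 0" by auto
  finally have "emeasure (distr disc_area borel norm) R = 0"
    using emeasure_distr[OF nm R] by simp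
  then have "(\<integral>\<^sup>+ r. ennreal (2 * r) * indicator {0..<1} r * indicator R r \<partial>lborel) = 0"
    unfolding distr_disc_area_norm by (subst (asm) emeasure_density) auto
  then have "AE r in lborel. ennreal (2 * r) * indicator {0..<1} r * indicator R r = 0"
    by (subst (asm) nn_integral_0_iff_AE) auto
  then have "AE r in lborel. r \<notin> R"
    using AE_lborel_singleton[of "0::real"]
    by eventually_elim (auto simp: R_def ennreal_eq_0_iff split: split_indicator_asm)
  then have "R \<in> null_sets lborel"
    using R by (simp add: AE_iff_null_sets)
  then have "R \<in> null_sets lebesgue" by (simp add: null_sets_completion_iff)
  then have "E \<inter> R \<in> sets lebesgue"
    using completion.complete2[of "E \<inter> R" R lborel] by auto
  moreover have "norm ` C \<in> sets lebesgue" using borel_norm[OF C(1)] by simp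
  moreover have "E = norm ` C \<union> (E \<inter> R)"
  proof -
    have "norm ` C \<subseteq> E" using C(3) by (auto simp: S_def)
    moreover have "norm ` C' \<inter> E = {}" using C'(3) by (auto simp: S_def)
    ultimately show ?thesis using E by (auto simp: R_def)
  qed
  ultimately show ?thesis by (metis sets.Un)
qed


text \<open>
  Replacing a radial weight by a Borel function of the radius lets all one-dimensional integrals be
  taken with respect to Borel measure, where Tonelli's theorem is available.
\<close>

definition is_profile :: "(complex \<Rightarrow> real) \<Rightarrow> (real \<Rightarrow> real) \<Rightarrow> bool" where
  "is_profile \<omega> g \<longleftrightarrow> g \<in> borel_measurable borel \<and> (\<forall>t. 0 \<le> g t) \<and>
     (AE t in lborel. t \<in> {0..<1} \<longrightarrow> \<omega> (complex_of_real t) = g t)"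

abbreviation profile_tail :: "(real \<Rightarrow> real) \<Rightarrow> real \<Rightarrow> ennreal" where
  "profile_tail g s \<equiv> (\<integral>\<^sup>+t\<in>{s..<1}. ennreal (g t) \<partial>lborel)"

text \<open>
  The sublevel sets of the profile have sublevel sets of \<open>\<omega>\<close> as their preimages under the norm, so
  they are Lebesgue measurable, and a Lebesgue measurable function agrees almost everywhere with a
  Borel one.
\<close>

lemma radial_weight_profile:
  assumes "radial_weight \<omega>"
  obtains g where "is_profile \<omega> g"
proof -
  have rad: "\<omega> z = \<omega> (complex_of_real (norm z))" and nonneg: "0 \<le> \<omega> z" if "z \<in> unit_disc" for z
    using assms that unfolding radial_weight_def by blast+
  have meas: "\<omega> \<in> borel_measurable disc_area"
    using assms unfolding radial_weight_def by blast
  define h where "h = (\<lambda>t. if t \<in> {0..<1} then \<omega> (complex_of_real t) else 0)"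
  have "h \<in> borel_measurable lebesgue"
  proof (rule borel_measurableI_less)
    fix y :: real
    define E where "E = {t \<in> {0..<1}. \<omega> (complex_of_real t) < y}"
    have "z \<in> unit_disc \<and> norm z \<in> E \<longleftrightarrow> z \<in> \<omega> -` {..<y} \<inter> space disc_area" for z
      by (cases "z \<in> unit_disc") (simp_all add: E_def rad[of z, symmetric])
    then have "{z \<in> unit_disc. norm z \<in> E} = \<omega> -` {..<y} \<inter> space disc_area"
      by blast
    also have "\<dots> \<in> sets disc_area" by (intro measurable_sets[OF meas]) simp
    finally have "E \<in> sets lebesgue"
      by (intro radial_set_lebesgue) (auto simp: E_def sets_disc_area_iff)
    moreover have "{x \<in> space lebesgue. h x < y} = E \<union> (if 0 < y then - {0..<1} else {})"
      by (auto simp: h_def E_def)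
    ultimately show "{x \<in> space lebesgue. h x < y} \<in> sets lebesgue" by auto
  qed
  then obtain g' where g': "g' \<in> borel_measurable lborel" "AE x in lborel. h x = g' x"
    using completion_ex_borel_measurable_real by blast
  have "is_profile \<omega> (\<lambda>t. max 0 (g' t))"
    unfolding is_profile_def
  proof (intro conjI allI)
    show "AE t in lborel. t \<in> {0..<1} \<longrightarrow> \<omega> (complex_of_real t) = max 0 (g' t)"
      using g'(2)
    proof eventually_elim
      case (elim t)
      show ?case
      proof
        assume "t \<in> {0..<1}"
        moreover from this have "0 \<le> \<omega> (complex_of_real t)" by (intro nonneg) auto
        ultimately show "\<omega> (complex_of_real t) = max 0 (g' t)" using elim by (simp add: h_def)
      qed
    qed
  qed (use g'(1) in auto)
  then show thesis by (rule that)
qed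

section \<open>Partial fractions and the beta integral\<close>

text \<open>
  The partial fraction decomposition of \<open>m! / ((x + 1) \<cdots> (x + m + 1))\<close>. Pascal's rule turns the sum
  for \<open>m + 1\<close> at \<open>x\<close> into the difference of the sums for \<open>m\<close> at \<open>x\<close> and at \<open>x + 1\<close>.
\<close>

lemma alternating_binomial_sum:
  fixes x :: real
  assumes "0 \<le> x"
  shows "(\<Sum>i\<le>m. (-1) ^ i * real (m choose i) / (x + 1 + real i)) = fact m / pochhammer (x + 1) (Suc m)"
  using assms
proof (induction m arbitrary: x)
  case 0
  then show ?case by simp
next
  case (Suc m)
  define S where "S = (\<lambda>y::real. \<Sum>i\<le>m. (-1) ^ i * real (m choose i) / (y + 1 + real i))"
  have S: "S y = fact m / pochhammer (y + 1) (Suc m)" if "0 \<le> y" for y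
    using Suc.IH[OF that] by (simp add: S_def)
  have "(\<Sum>i\<le>Suc m. (-1) ^ i * real (Suc m choose i) / (x + 1 + real i)) =
      1 / (x + 1) + (\<Sum>i\<le>m. (-1) ^ Suc i * real (Suc m choose Suc i) / (x + 1 + real (Suc i)))"
    by (subst sum.atMost_Suc_shift) simp
  also have "(\<Sum>i\<le>m. (-1) ^ Suc i * real (Suc m choose Suc i) / (x + 1 + real (Suc i))) =
      (\<Sum>i\<le>m. (-1) ^ Suc i * real (m choose Suc i) / (x + 1 + real (Suc i))) - S (x + 1)"
    unfolding S_def sum_subtractf[symmetric]
    by (intro sum.cong refl) (simp add: algebra_simps flip: diff_divide_distrib add_divide_distrib)
  also have "1 / (x + 1) + ((\<Sum>i\<le>m. (-1) ^ Suc i * real (m choose Suc i) / (x + 1 + real (Suc i))) - S (x + 1)) =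
      (\<Sum>i\<le>Suc m. (-1) ^ i * real (m choose i) / (x + 1 + real i)) - S (x + 1)"
    by (subst sum.atMost_Suc_shift) simp
  also have "(\<Sum>i\<le>Suc m. (-1) ^ i * real (m choose i) / (x + 1 + real i)) = S x"
    by (simp add: S_def)
  also have "S x - S (x + 1) = fact m / pochhammer (x + 1) (Suc m) - fact m / pochhammer (x + 1 + 1) (Suc m)"
    using Suc.prems by (simp only: S)
  also have "\<dots> = fact (Suc m) / pochhammer (x + 1) (Suc (Suc m))"
  proof -
    define P where "P = pochhammer (x + 1 + 1) m"
    have P: "P > 0" unfolding P_def using Suc.prems by (intro pochhammer_pos) auto
    have 1: "pochhammer (x + 1) (Suc m) = (x + 1) * P"
      by (simp add: P_def pochhammer_rec)
    have 2: "pochhammer (x + 1 + 1) (Suc m) = P * (x + 2 + real m)"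
      by (simp add: P_def pochhammer_Suc algebra_simps)
    have 3: "pochhammer (x + 1) (Suc (Suc m)) = (x + 1) * P * (x + 2 + real m)"
      by (subst pochhammer_Suc) (simp only: 1, simp add: algebra_simps)
    have "x + 1 > 0" "x + 2 + real m > 0" using Suc.prems by auto
    then show ?thesis unfolding 1 2 3 using P by (simp add: divide_simps) (simp add: algebra_simps)
  qed
  finally show ?case .
qed

text \<open>
  Multiplying by all the denominators gives a polynomial in \<open>k\<close> with infinitely many zeros, so the
  zero polynomial; its value at \<open>- j\<close> is \<open>D j\<close> times a nonzero product.
\<close>

lemma partial_fractions_unique:
  fixes D :: "nat \<Rightarrow> real"
  assumes "\<And>k. 1 \<le> k \<Longrightarrow> (\<Sum>j=1..n. D j / (real k + real j)) = 0" and j: "j \<in> {1..n}"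
  shows "D j = 0"
proof -
  define p where "p = (\<Sum>j=1..n. smult (D j) (\<Prod>i\<in>{1..n} - {j}. [:real i, 1:]))"
  have ev: "poly p x = (\<Sum>j=1..n. D j * (\<Prod>i\<in>{1..n} - {j}. (x + real i)))" for x
    by (simp add: p_def poly_sum poly_prod add.commute)
  have "poly p (real k) = 0" if k: "1 \<le> k" for k :: nat
  proof -
    have "poly p (real k) = (\<Sum>j=1..n. (\<Prod>i=1..n. (real k + real i)) * (D j / (real k + real j)))"
      unfolding ev
    proof (intro sum.cong refl)
      fix j assume "j \<in> {1..n}"
      then have "(\<Prod>i=1..n. (real k + real i)) = (real k + real j) * (\<Prod>i\<in>{1..n} - {j}. (real k + real i))"
        by (intro prod.remove) auto
      then show "D j * (\<Prod>i\<in>{1..n} - {j}. (real k + real i)) = (\<Prod>i=1..n. (real k + real i)) * (D j / (real k + real j))"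
        using k by simp
    qed
    also have "\<dots> = (\<Prod>i=1..n. (real k + real i)) * (\<Sum>j=1..n. D j / (real k + real j))"
      by (simp add: sum_distrib_left)
    finally show ?thesis using assms(1)[OF k] by simp
  qed
  then have "real ` {1..} \<subseteq> {x. poly p x = 0}" by auto
  moreover have "infinite (real ` {1..})"
    by (subst finite_image_iff) (auto simp: infinite_Ici)
  ultimately have "p = 0" using poly_roots_finite finite_subset by blast
  then have "0 = poly p (- real j)" by simp
  also have "\<dots> = (\<Sum>l\<in>{j}. D l * (\<Prod>i\<in>{1..n} - {l}. (- real j + real i)))"
    unfolding ev using j
    by (intro sum.mono_neutral_right) (auto intro!: prod_zero)
  finally show ?thesis by auto
qed

text \<open>
  Expanding \<open>(t\<^sup>2 - s\<^sup>2)^m\<close> and integrating termwise produces the sum of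
  \<open>alternating_binomial_sum\<close> at \<open>x = k\<close>.
\<close>

lemma beta_integral:
  fixes t :: real
  assumes "0 \<le> t"
  shows "(\<integral>\<^sup>+s\<in>{0..t}. ennreal (2 * s ^ (2 * k + 1) * (t\<^sup>2 - s\<^sup>2) ^ m) \<partial>lborel) =
    ennreal (t ^ (2 * (k + m + 1)) * (fact k * fact m / fact (k + m + 1)))"
proof -
  define F where "F = (\<lambda>s. \<Sum>i\<le>m. (-1) ^ i * real (m choose i) * t ^ (2 * (m - i)) *
      (s ^ (2 * (k + i + 1)) / (real k + 1 + real i)))"
  have D: "DERIV F s :> 2 * s ^ (2 * k + 1) * (t\<^sup>2 - s\<^sup>2) ^ m" for s
  proof -
    have "DERIV F s :> (\<Sum>i\<le>m. (-1) ^ i * real (m choose i) * t ^ (2 * (m - i)) * (2 * s ^ (2 * (k + i) + 1)))"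
      unfolding F_def
    proof (intro DERIV_sum DERIV_cmult)
      fix i
      have "DERIV (\<lambda>s. s ^ (2 * (k + i + 1)) / (real k + 1 + real i)) s :>
          real (2 * (k + i + 1)) * s ^ (2 * (k + i + 1) - 1) / (real k + 1 + real i)"
        using DERIV_cdivide[OF DERIV_pow[of "2 * (k + i + 1)" s]] by simp
      also have "real (2 * (k + i + 1)) * s ^ (2 * (k + i + 1) - 1) / (real k + 1 + real i) = 2 * s ^ (2 * (k + i) + 1)"
        by (simp add: divide_simps)
      finally show "DERIV (\<lambda>s. s ^ (2 * (k + i + 1)) / (real k + 1 + real i)) s :> 2 * s ^ (2 * (k + i) + 1)" .
    qed
    also have "(\<Sum>i\<le>m. (-1) ^ i * real (m choose i) * t ^ (2 * (m - i)) * (2 * s ^ (2 * (k + i) + 1)))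
        = 2 * s ^ (2 * k + 1) * (\<Sum>i\<le>m. real (m choose i) * (- (s\<^sup>2)) ^ i * (t\<^sup>2) ^ (m - i))"
      unfolding sum_distrib_left
    proof (intro sum.cong refl)
      fix i
      have 1: "s ^ (2 * (k + i) + 1) = s ^ (2 * k + 1) * (s\<^sup>2) ^ i"
        by (simp add: power_add power_mult)
      have 2: "t ^ (2 * (m - i)) = (t\<^sup>2) ^ (m - i)"
        by (simp add: power_mult)
      show "(-1) ^ i * real (m choose i) * t ^ (2 * (m - i)) * (2 * s ^ (2 * (k + i) + 1)) =
          2 * s ^ (2 * k + 1) * (real (m choose i) * (- (s\<^sup>2)) ^ i * (t\<^sup>2) ^ (m - i))"
        unfolding 1 2 power_minus[of "s\<^sup>2"] by (simp only: mult_ac)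
    qed
    also have "(\<Sum>i\<le>m. real (m choose i) * (- (s\<^sup>2)) ^ i * (t\<^sup>2) ^ (m - i)) = (t\<^sup>2 - s\<^sup>2) ^ m"
      using binomial_ring[of "- (s\<^sup>2)" "t\<^sup>2" m] by simp
    finally show ?thesis .
  qed
  have nn: "0 \<le> 2 * s ^ (2 * k + 1) * (t\<^sup>2 - s\<^sup>2) ^ m" if "0 \<le> s" "s \<le> t" for s
    using that by (intro mult_nonneg_nonneg zero_le_power) (auto intro: power_mono)
  have "(\<integral>\<^sup>+s\<in>{0..t}. ennreal (2 * s ^ (2 * k + 1) * (t\<^sup>2 - s\<^sup>2) ^ m) \<partial>lborel) = F t - F 0"
    using assms D nn by (intro nn_integral_FTC_Icc) auto
  also have "F 0 = 0" by (simp add: F_def)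
  also have "F t = t ^ (2 * (k + m + 1)) * (\<Sum>i\<le>m. (-1) ^ i * real (m choose i) / (real k + 1 + real i))"
    unfolding F_def sum_distrib_left
  proof (intro sum.cong refl)
    fix i assume "i \<in> {..m}"
    then have "2 * (k + m + 1) = 2 * (m - i) + 2 * (k + i + 1)" by simp
    then have "t ^ (2 * (k + m + 1)) = t ^ (2 * (m - i)) * t ^ (2 * (k + i + 1))"
      by (metis power_add)
    then show "(-1) ^ i * real (m choose i) * t ^ (2 * (m - i)) * (t ^ (2 * (k + i + 1)) / (real k + 1 + real i)) =
        t ^ (2 * (k + m + 1)) * ((-1) ^ i * real (m choose i) / (real k + 1 + real i))"
      by (simp only: mult_ac times_divide_eq_right)
  qed
  also have "(\<Sum>i\<le>m. (-1) ^ i * real (m choose i) / (real k + 1 + real i)) = fact k * fact m / fact (k + m + 1)"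
  proof -
    have "pochhammer (1::real) (k + Suc m) = pochhammer 1 k * pochhammer (1 + real k) (Suc m)"
      by (rule pochhammer_product')
    then have "fact (k + m + 1) = fact k * pochhammer (real k + 1) (Suc m)"
      by (simp only: pochhammer_fact[symmetric] add.commute) simp
    then show ?thesis
      using alternating_binomial_sum[of "real k" m] by simp
  qed
  finally show ?thesis by simp
qed

lemma shell_integral:
  fixes s t :: real
  assumes "0 \<le> s" "s \<le> t"
  shows "(\<integral>\<^sup>+r\<in>{s..t}. ennreal (r * (t\<^sup>2 - r\<^sup>2) ^ m) \<partial>lborel) =
    ennreal ((t\<^sup>2 - s\<^sup>2) ^ Suc m / (2 * real (Suc m)))"
proof -
  define F where "F = (\<lambda>r. - ((t\<^sup>2 - r\<^sup>2) ^ Suc m / (2 * real (Suc m))))"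
  have D: "DERIV F r :> r * (t\<^sup>2 - r\<^sup>2) ^ m" for r
  proof -
    have "DERIV (\<lambda>r. t\<^sup>2 - r\<^sup>2) r :> - (2 * r)"
      by (auto intro!: derivative_eq_intros)
    from DERIV_minus[OF DERIV_cdivide[OF DERIV_power_Suc[OF this, of m], of "2 * real (Suc m)"]]
    have "DERIV F r :> - ((1 + real m) * (- (2 * r) * (t\<^sup>2 - r\<^sup>2) ^ m) / (2 * real (Suc m)))"
      by (simp add: F_def)
    also have "- ((1 + real m) * (- (2 * r) * (t\<^sup>2 - r\<^sup>2) ^ m) / (2 * real (Suc m))) = r * (t\<^sup>2 - r\<^sup>2) ^ m"
      by (simp add: divide_simps)
    finally show ?thesis .
  qed
  have "(\<integral>\<^sup>+r\<in>{s..t}. ennreal (r * (t\<^sup>2 - r\<^sup>2) ^ m) \<partial>lborel) = F t - F s"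
    using assms D by (intro nn_integral_FTC_Icc) (auto intro!: mult_nonneg_nonneg zero_le_power power_mono)
  then show ?thesis by (simp add: F_def)
qed

section \<open>Collapsing the iterated integral\<close>

lemma measurable_tail_integral:
  fixes f :: "real \<Rightarrow> real \<Rightarrow> ennreal"
  assumes [measurable]: "case_prod f \<in> borel_measurable (borel \<Otimes>\<^sub>M borel)"
  shows "(\<lambda>s. \<integral>\<^sup>+t\<in>{s..<1}. f s t \<partial>lborel) \<in> borel_measurable borel"
proof -
  have "(\<lambda>(s, t). f s t * (indicator {x. fst x \<le> snd x \<and> snd x < 1} (s, t))) \<in> borel_measurable (borel \<Otimes>\<^sub>M lborel)"
    by measurable
  then have "(\<lambda>s. \<integral>\<^sup>+t. f s t * (indicator {x. fst x \<le> snd x \<and> snd x < 1} (s, t)) \<partial>lborel) \<in> borel_measurable borel"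
    by (rule lborel.borel_measurable_nn_integral)
  moreover have "indicator {x. fst x \<le> snd x \<and> snd x < 1} (s, t) = (indicator {s..<1} t :: ennreal)" for s t :: real
    by (auto split: split_indicator)
  ultimately show ?thesis by simp
qed

text \<open>
  Both sides integrate over the triangle \<open>s \<le> r \<le> t < 1\<close>.
\<close>

lemma nn_integral_tail_Tonelli:
  fixes f :: "real \<Rightarrow> real \<Rightarrow> ennreal"
  assumes f[measurable]: "case_prod f \<in> borel_measurable (borel \<Otimes>\<^sub>M borel)"
  shows "(\<integral>\<^sup>+r\<in>{s..<1}. (\<integral>\<^sup>+t\<in>{r..<1}. f r t \<partial>lborel) \<partial>lborel) =
    (\<integral>\<^sup>+t\<in>{s..<1}. (\<integral>\<^sup>+r\<in>{s..t}. f r t \<partial>lborel) \<partial>lborel)"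
proof -
  have "(\<integral>\<^sup>+r\<in>{s..<1}. (\<integral>\<^sup>+t\<in>{r..<1}. f r t \<partial>lborel) \<partial>lborel) =
      (\<integral>\<^sup>+r. (\<integral>\<^sup>+t. f r t * indicator {x. s \<le> fst x \<and> fst x \<le> snd x \<and> snd x < 1} (r, t) \<partial>lborel) \<partial>lborel)"
  proof (intro nn_integral_cong)
    fix r
    have [measurable]: "f r \<in> borel_measurable borel"
      using measurable_compose[OF measurable_Pair1'[of r borel borel] f] by simp
    show "(\<integral>\<^sup>+t\<in>{r..<1}. f r t \<partial>lborel) * indicator {s..<1} r =
        (\<integral>\<^sup>+t. f r t * indicator {x. s \<le> fst x \<and> fst x \<le> snd x \<and> snd x < 1} (r, t) \<partial>lborel)"
      by (subst nn_integral_multc[symmetric]) (auto intro!: nn_integral_cong split: split_indicator)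
  qed
  also have "\<dots> = (\<integral>\<^sup>+t. (\<integral>\<^sup>+r. f r t * indicator {x. s \<le> fst x \<and> fst x \<le> snd x \<and> snd x < 1} (r, t) \<partial>lborel) \<partial>lborel)"
    by (rule lborel_pair.Fubini'[symmetric]) measurable
  also have "\<dots> = (\<integral>\<^sup>+t\<in>{s..<1}. (\<integral>\<^sup>+r\<in>{s..t}. f r t \<partial>lborel) \<partial>lborel)"
  proof (intro nn_integral_cong)
    fix t
    have [measurable]: "(\<lambda>r. f r t) \<in> borel_measurable borel"
      using measurable_compose[OF measurable_Pair2'[of t borel borel] f] by simp
    show "(\<integral>\<^sup>+r. f r t * indicator {x. s \<le> fst x \<and> fst x \<le> snd x \<and> snd x < 1} (r, t) \<partial>lborel) =
        (\<integral>\<^sup>+r\<in>{s..t}. f r t \<partial>lborel) * indicator {s..<1} t"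
      by (subst nn_integral_multc[symmetric]) (auto intro!: nn_integral_cong split: split_indicator)
  qed
  finally show ?thesis .
qed

text \<open>
  Lets the profile of a weight replace the weight inside \<open>nested\<close>.
\<close>

lemma nested_cong_AE:
  assumes ae: "AE r in lebesgue. r \<in> {0..<1} \<longrightarrow> u r = v r"
    and v: "v \<in> borel_measurable borel" and "0 \<le> s"
  shows "nested u m s = nested v m s"
  using \<open>0 \<le> s\<close>
proof (induction m arbitrary: s)
  case 0
  have ae': "AE r in lebesgue. indicator {s..<1} r *\<^sub>R v r = indicator {s..<1} r *\<^sub>R u r"
    using ae by eventually_elim (use \<open>0 \<le> s\<close> in \<open>auto split: split_indicator\<close>)
  have "(\<lambda>r. indicator {s..<1} r *\<^sub>R v r) \<in> borel_measurable lborel"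
    using v by measurable
  then have v': "(\<lambda>r. indicator {s..<1} r *\<^sub>R v r) \<in> borel_measurable lebesgue"
    by (rule measurable_completion)
  have u': "(\<lambda>r. indicator {s..<1} r *\<^sub>R u r) \<in> borel_measurable lebesgue"
    by (rule borel_measurable_AE[OF v' ae'])
  show ?case
    unfolding nested.simps set_lebesgue_integral_def
    by (rule integral_cong_AE[OF u' v']) (use ae' in \<open>eventually_elim, metis\<close>)
next
  case (Suc m)
  show ?case
    unfolding nested.simps set_lebesgue_integral_def
    by (intro Bochner_Integration.integral_cong refl) (use Suc in \<open>auto split: split_indicator\<close>)
qed

text \<open>
  Up to the factor \<open>2^m m!\<close> this is the iterated integral \<open>nested g m s\<close>, as an extended
  real number: the set \<open>s \<le> r\<^sub>1 \<le> \<dots> \<le> r\<^sub>m \<le> t\<close> has mass \<open>(t\<^sup>2 - s\<^sup>2)^m / (2^m m!)\<close> with respect to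
  \<open>r\<^sub>1 \<cdots> r\<^sub>m dr\<^sub>1 \<cdots> dr\<^sub>m\<close>.
\<close>

definition shell :: "(real \<Rightarrow> real) \<Rightarrow> nat \<Rightarrow> real \<Rightarrow> ennreal" where
  "shell g m s = (\<integral>\<^sup>+t\<in>{s..<1}. ennreal (g t * (t\<^sup>2 - s\<^sup>2) ^ m) \<partial>lborel)"

lemma measurable_shell [measurable]:
  assumes [measurable]: "g \<in> borel_measurable borel"
  shows "shell g m \<in> borel_measurable borel"
  unfolding shell_def[abs_def] by (rule measurable_tail_integral) measurable

lemma shell_finite:
  assumes g: "\<And>t. 0 \<le> t \<Longrightarrow> 0 \<le> g t" and s: "0 \<le> s"
    and fin: "profile_tail g s < \<infinity>"
  shows "shell g m s < \<infinity>"
proof -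
  have "shell g m s \<le> profile_tail g s"
    unfolding shell_def
  proof (intro nn_integral_mono)
    fix t
    have "g t * (t\<^sup>2 - s\<^sup>2) ^ m \<le> g t" if "s \<le> t" "t < 1"
    proof -
      have "s\<^sup>2 \<le> t\<^sup>2" using that s by (intro power_mono) auto
      moreover have "t\<^sup>2 \<le> 1" using that s by (intro power_le_one) auto
      ultimately have "(t\<^sup>2 - s\<^sup>2) ^ m \<le> 1"
        using zero_le_power2[of s] by (intro power_le_one) linarith+
      then show ?thesis using g[of t] that s mult_left_mono[of "(t\<^sup>2 - s\<^sup>2) ^ m" 1 "g t"] by auto
    qed
    then show "ennreal (g t * (t\<^sup>2 - s\<^sup>2) ^ m) * indicator {s..<1} t \<le> ennreal (g t) * indicator {s..<1} t"
      by (auto intro!: ennreal_leI split: split_indicator)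
  qed
  then show ?thesis using fin by (rule le_less_trans)
qed

lemma nn_integral_shell:
  assumes [measurable]: "g \<in> borel_measurable borel" and g: "\<And>t. 0 \<le> t \<Longrightarrow> 0 \<le> g t" and s: "0 \<le> s"
  shows "(\<integral>\<^sup>+r\<in>{s..<1}. ennreal r * shell g m r \<partial>lborel) = ennreal (1 / (2 * real (Suc m))) * shell g (Suc m) s"
proof -
  have "(\<integral>\<^sup>+r\<in>{s..<1}. ennreal r * shell g m r \<partial>lborel) =
      (\<integral>\<^sup>+r\<in>{s..<1}. (\<integral>\<^sup>+t\<in>{r..<1}. ennreal r * ennreal (g t * (t\<^sup>2 - r\<^sup>2) ^ m) \<partial>lborel) \<partial>lborel)"
    unfolding shell_def
    by (subst nn_integral_cmult[symmetric]) (auto simp: mult.assoc)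
  also have "\<dots> = (\<integral>\<^sup>+t\<in>{s..<1}. (\<integral>\<^sup>+r\<in>{s..t}. ennreal r * ennreal (g t * (t\<^sup>2 - r\<^sup>2) ^ m) \<partial>lborel) \<partial>lborel)"
    by (rule nn_integral_tail_Tonelli) measurable
  also have "\<dots> = (\<integral>\<^sup>+t. ennreal (1 / (2 * real (Suc m))) * (ennreal (g t * (t\<^sup>2 - s\<^sup>2) ^ Suc m) * indicator {s..<1} t) \<partial>lborel)"
  proof (intro nn_integral_cong)
    fix t
    show "(\<integral>\<^sup>+r\<in>{s..t}. ennreal r * ennreal (g t * (t\<^sup>2 - r\<^sup>2) ^ m) \<partial>lborel) * indicator {s..<1} t =
       ennreal (1 / (2 * real (Suc m))) * (ennreal (g t * (t\<^sup>2 - s\<^sup>2) ^ Suc m) * indicator {s..<1} t)"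
    proof (cases "s \<le> t \<and> t < 1")
      case True
      then have gt: "0 \<le> g t" using g s by auto
      have "(\<integral>\<^sup>+r\<in>{s..t}. ennreal r * ennreal (g t * (t\<^sup>2 - r\<^sup>2) ^ m) \<partial>lborel) =
          (\<integral>\<^sup>+r. ennreal (g t) * (ennreal (r * (t\<^sup>2 - r\<^sup>2) ^ m) * indicator {s..t} r) \<partial>lborel)"
        using gt s by (intro nn_integral_cong) (auto simp: ennreal_mult'[symmetric] mult_ac split: split_indicator)
      also have "\<dots> = ennreal (g t) * ennreal ((t\<^sup>2 - s\<^sup>2) ^ Suc m / (2 * real (Suc m)))"
        using True s by (subst nn_integral_cmult) (auto simp: shell_integral simp del: power_Suc of_nat_Suc)
      finally show ?thesis using True gt
        by (simp add: ennreal_mult'[symmetric] del: power_Suc of_nat_Suc)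
    qed auto
  qed
  also have "\<dots> = ennreal (1 / (2 * real (Suc m))) * shell g (Suc m) s"
    unfolding shell_def by (rule nn_integral_cmult) measurable
  finally show ?thesis .
qed

text \<open>
  Induction on the number of integrations, with \<open>nn_integral_shell\<close> as the step. Integrability of
  \<open>g\<close> is demanded on \<open>[s, 1)\<close> for \<open>s > 0\<close> only. At the origin both sides may come from a divergent
  integral, and they still agree: the Bochner integral of a nonnegative function that is not
  integrable is \<open>0\<close>, and so is \<open>enn2real \<infinity>\<close>.
\<close>

lemma nested_eq_shell:
  assumes gm[measurable]: "g \<in> borel_measurable borel" and g: "\<And>t. 0 \<le> t \<Longrightarrow> 0 \<le> g t"
    and fin: "\<And>s. 0 < s \<Longrightarrow> profile_tail g s < \<infinity>" and s: "0 \<le> s"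
  shows "nested g m s = enn2real (shell g m s) / (2 ^ m * fact m)"
  using s
proof (induction m arbitrary: s)
  case 0
  have "nested g 0 s = (LINT r|lebesgue. indicator {s..<1} r *\<^sub>R g r)"
    by (simp add: set_lebesgue_integral_def)
  also have "\<dots> = (LINT r|lborel. indicator {s..<1} r *\<^sub>R g r)"
    by (subst integral_completion) auto
  also have "\<dots> = enn2real (\<integral>\<^sup>+r. ennreal (indicator {s..<1} r *\<^sub>R g r) \<partial>lborel)"
    using 0 g by (intro integral_eq_nn_integral) (auto split: split_indicator)
  also have "(\<integral>\<^sup>+r. ennreal (indicator {s..<1} r *\<^sub>R g r) \<partial>lborel) = shell g 0 s"
    unfolding shell_def by (intro nn_integral_cong) (auto split: split_indicator)
  finally show ?case by simp
next
  case (Suc m)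
  have "nested g (Suc m) s = (LINT r|lebesgue. indicator {s..<1} r *\<^sub>R (r * nested g m r))"
    by (simp add: set_lebesgue_integral_def)
  also have "\<dots> = (LINT r|lebesgue. indicator {s..<1} r *\<^sub>R (r * (enn2real (shell g m r) / (2 ^ m * fact m))))"
    using Suc by (intro Bochner_Integration.integral_cong refl) (auto split: split_indicator)
  also have "\<dots> = (LINT r|lborel. indicator {s..<1} r *\<^sub>R (r * (enn2real (shell g m r) / (2 ^ m * fact m))))"
    by (subst integral_completion) auto
  also have "\<dots> = enn2real (\<integral>\<^sup>+r. ennreal (indicator {s..<1} r *\<^sub>R (r * (enn2real (shell g m r) / (2 ^ m * fact m)))) \<partial>lborel)"
    using Suc.prems by (intro integral_eq_nn_integral) (auto split: split_indicator)
  also have "(\<integral>\<^sup>+r. ennreal (indicator {s..<1} r *\<^sub>R (r * (enn2real (shell g m r) / (2 ^ m * fact m)))) \<partial>lborel) =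
     (\<integral>\<^sup>+r. ennreal (1 / (2 ^ m * fact m)) * (ennreal r * shell g m r * indicator {s..<1} r) \<partial>lborel)"
  proof (intro nn_integral_cong)
    fix r
    show "ennreal (indicator {s..<1} r *\<^sub>R (r * (enn2real (shell g m r) / (2 ^ m * fact m)))) =
      ennreal (1 / (2 ^ m * fact m)) * (ennreal r * shell g m r * indicator {s..<1} r)"
    proof (cases "s \<le> r \<and> r < 1 \<and> r \<noteq> 0")
      case True
      then have r: "0 < r" using Suc.prems by auto
      have "shell g m r < \<infinity>" using r fin g by (intro shell_finite) auto
      then have "shell g m r = ennreal (enn2real (shell g m r))" by simp
      define e where "e = enn2real (shell g m r)"
      have "0 \<le> e" by (simp add: e_def)
      then have "ennreal (r * (e / (2 ^ m * fact m))) = ennreal (1 / (2 ^ m * fact m)) * (ennreal r * ennreal e)"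
        using r by (simp add: ennreal_mult'[symmetric])
      then show ?thesis using True \<open>shell g m r = _\<close> by (simp add: e_def)
    qed (auto split: split_indicator)
  qed
  also have "\<dots> = ennreal (1 / (2 ^ m * fact m)) * (ennreal (1 / (2 * real (Suc m))) * shell g (Suc m) s)"
    by (subst nn_integral_cmult) (use nn_integral_shell[OF gm g Suc.prems] in auto)
  finally show ?case
    by (simp add: enn2real_mult del: of_nat_Suc)
qed

section \<open>Radial weights and their moments\<close>

lemma radial_weightD:
  assumes "radial_weight \<omega>"
  shows radial_weight_nonneg: "z \<in> unit_disc \<Longrightarrow> 0 \<le> \<omega> z"
    and radial_weight_radial: "z \<in> unit_disc \<Longrightarrow> \<omega> z = \<omega> (complex_of_real (norm z))"
    and radial_weight_integrable: "integrable disc_area \<omega>"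
    and radial_weight_tail_pos: "z \<in> unit_disc \<Longrightarrow> 0 < tail \<omega> z"
  using assms unfolding radial_weight_def by blast+

lemma is_profileD:
  assumes "is_profile \<omega> g"
  shows profile_measurable: "g \<in> borel_measurable borel" and profile_nonneg: "0 \<le> g t"
    and profile_AE: "AE t in lborel. t \<in> {0..<1} \<longrightarrow> \<omega> (complex_of_real t) = g t"
  using assms unfolding is_profile_def by blast+

lemma tail_eq_profile:
  assumes "is_profile \<omega> g"
  shows "tail \<omega> z = profile_tail g (norm z)"
proof -
  have "tail \<omega> z = (\<integral>\<^sup>+t\<in>{norm z..<1}. ennreal (\<omega> (complex_of_real t)) \<partial>lborel)"
    unfolding tail_def by (simp add: nn_integral_completion)
  also have "\<dots> = profile_tail g (norm z)"
    using profile_AE[OF assms]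
  proof (intro nn_integral_cong_AE, eventually_elim)
    case (elim t)
    show ?case using elim order_trans[OF norm_ge_zero, of z t] by (auto split: split_indicator)
  qed
  finally show ?thesis .
qed

lemma AE_disc_profile:
  assumes "radial_weight \<omega>" "is_profile \<omega> g"
  shows "AE z in disc_area. \<omega> z = g (norm z)"
proof -
  have "AE z in disc_area. z \<in> unit_disc"
    using AE_space[of disc_area] by simp
  with AE_disc_area_norm[OF profile_AE[OF assms(2)]] show ?thesis
    by eventually_elim (use radial_weight_radial[OF assms(1)] in metis)
qed

lemma nn_integral_radial_weight:
  assumes \<omega>: "radial_weight \<omega>" "is_profile \<omega> g" and u[measurable]: "u \<in> borel_measurable borel"
  shows "(\<integral>\<^sup>+z. u (norm z) * ennreal (\<omega> z) \<partial>disc_area) =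
    (\<integral>\<^sup>+r\<in>{0..<1}. ennreal (2 * r) * (u r * ennreal (g r)) \<partial>lborel)"
proof -
  note [measurable] = profile_measurable[OF \<omega>(2)]
  have "(\<integral>\<^sup>+z. u (norm z) * ennreal (\<omega> z) \<partial>disc_area) = (\<integral>\<^sup>+z. u (norm z) * ennreal (g (norm z)) \<partial>disc_area)"
    using AE_disc_profile[OF \<omega>] by (intro nn_integral_cong_AE) auto
  also have "\<dots> = (\<integral>\<^sup>+r\<in>{0..<1}. ennreal (2 * r) * (u r * ennreal (g r)) \<partial>lborel)"
    by (rule nn_integral_disc_area_radial) measurable
  finally show ?thesis .
qed

text \<open>
  Integrability on the disc controls \<open>2 t g(t)\<close>, which is bounded below by \<open>2 s g(t)\<close> for \<open>t \<ge> s\<close>.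
\<close>

lemma profile_tail_finite:
  assumes \<omega>: "radial_weight \<omega>" "is_profile \<omega> g" and s: "0 < s"
  shows "profile_tail g s < \<infinity>"
proof -
  note [measurable] = profile_measurable[OF \<omega>(2)]
  have g: "0 \<le> g t" for t by (rule profile_nonneg[OF \<omega>(2)])
  have "profile_tail g s \<le>
      (\<integral>\<^sup>+t. ennreal (1 / (2 * s)) * (ennreal (2 * t) * (1 * ennreal (g t)) * indicator {0..<1} t) \<partial>lborel)"
  proof (intro nn_integral_mono)
    fix t
    have "g t \<le> 1 / (2 * s) * (2 * t * g t)" if "s \<le> t"
      using mult_left_mono[OF that g[of t]] s by (simp add: divide_simps mult.commute)
    then show "ennreal (g t) * indicator {s..<1} t \<le>
        ennreal (1 / (2 * s)) * (ennreal (2 * t) * (1 * ennreal (g t)) * indicator {0..<1} t)"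
      using s g by (auto intro!: ennreal_leI simp: ennreal_mult'[symmetric] split: split_indicator)
  qed
  also have "\<dots> = ennreal (1 / (2 * s)) * (\<integral>\<^sup>+z. 1 * ennreal (\<omega> z) \<partial>disc_area)"
    using nn_integral_radial_weight[OF \<omega>, of "\<lambda>_. 1"]
    by (subst nn_integral_cmult) auto
  also have "\<dots> < \<infinity>"
  proof -
    have "(\<integral>\<^sup>+z. ennreal (norm (\<omega> z)) \<partial>disc_area) < \<infinity>"
      using radial_weight_integrable[OF \<omega>(1)] by (simp add: integrable_iff_bounded)
    moreover have "(\<integral>\<^sup>+z. ennreal (norm (\<omega> z)) \<partial>disc_area) = (\<integral>\<^sup>+z. 1 * ennreal (\<omega> z) \<partial>disc_area)"
      using radial_weight_nonneg[OF \<omega>(1)] by (intro nn_integral_cong) auto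
    ultimately show ?thesis by (simp add: ennreal_mult_less_top)
  qed
  finally show ?thesis .
qed

text \<open>
  The squared norm of \<open>z^k\<close> in the Bergman space of \<open>\<omega>\<close>.
\<close>

definition moment :: "(complex \<Rightarrow> real) \<Rightarrow> nat \<Rightarrow> real" where
  "moment \<omega> k = (LINT z|disc_area. norm z ^ (2 * k) * \<omega> z)"

lemma borel_measurable_norm_disc: "(\<lambda>z. norm z) \<in> borel_measurable disc_area"
  by (intro borel_measurable_disc_areaI) simp

lemma integrable_norm_power_weight:
  assumes "radial_weight \<omega>"
  shows "integrable disc_area (\<lambda>z. norm z ^ k * \<omega> z)"
proof (rule Bochner_Integration.integrable_bound[OF radial_weight_integrable[OF assms]])
  note [measurable] = borel_measurable_integrable[OF radial_weight_integrable[OF assms]] borel_measurable_norm_disc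
  show "(\<lambda>z. norm z ^ k * \<omega> z) \<in> borel_measurable disc_area" by measurable
  show "AE z in disc_area. norm (norm z ^ k * \<omega> z) \<le> norm (\<omega> z)"
    by (rule AE_I2) (auto simp: abs_mult intro!: mult_left_le_one_le power_le_one)
qed

lemma moment_profile:
  assumes \<omega>: "radial_weight \<omega>" "is_profile \<omega> g"
  shows "ennreal (moment \<omega> k) = (\<integral>\<^sup>+r\<in>{0..<1}. ennreal (2 * r ^ (2 * k + 1)) * ennreal (g r) \<partial>lborel)"
proof -
  have "ennreal (moment \<omega> k) = (\<integral>\<^sup>+z. ennreal (norm z ^ (2 * k) * \<omega> z) \<partial>disc_area)"
    unfolding moment_def using radial_weight_nonneg[OF \<omega>(1)]
    by (intro nn_integral_eq_integral[symmetric] integrable_norm_power_weight[OF \<omega>(1)] AE_I2) auto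
  also have "\<dots> = (\<integral>\<^sup>+z. ennreal (norm z ^ (2 * k)) * ennreal (\<omega> z) \<partial>disc_area)"
    by (intro nn_integral_cong ennreal_mult') auto
  also have "\<dots> = (\<integral>\<^sup>+r\<in>{0..<1}. ennreal (2 * r) * (ennreal (r ^ (2 * k)) * ennreal (g r)) \<partial>lborel)"
    by (rule nn_integral_radial_weight[OF \<omega>]) measurable
  also have "\<dots> = (\<integral>\<^sup>+r\<in>{0..<1}. ennreal (2 * r ^ (2 * k + 1)) * ennreal (g r) \<partial>lborel)"
    by (intro nn_integral_cong)
       (auto split: split_indicator simp: mult.assoc[symmetric] simp flip: ennreal_mult')
  finally show ?thesis .
qed

text \<open>
  Only the mass on \<open>\<rho> \<le> |z| < 1\<close> is kept, which is positive by the standing assumption on tails. As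
  \<open>\<rho>\<close> can be taken close to \<open>1\<close>, the kernel series converges for every \<open>z\<close> in the disc.
\<close>

lemma moment_lower_bound:
  assumes \<omega>: "radial_weight \<omega>" and \<rho>: "0 < \<rho>" "\<rho> < 1"
  obtains c where "0 < c" "\<And>k. c * \<rho> ^ (2 * k) \<le> moment \<omega> k"
proof -
  obtain g where g: "is_profile \<omega> g" using radial_weight_profile[OF \<omega>] .
  note [measurable] = profile_measurable[OF g]
  have g0: "0 \<le> g t" for t by (rule profile_nonneg[OF g])
  define T where "T = profile_tail g \<rho>"
  have T: "T < \<infinity>" "0 < T"
    using profile_tail_finite[OF \<omega> g \<rho>(1)] radial_weight_tail_pos[OF \<omega>, of "complex_of_real \<rho>"] \<rho>
    unfolding tail_eq_profile[OF g] by (auto simp: T_def)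
  then have Tr: "T = ennreal (enn2real T)" and Tp: "0 < enn2real T"
    by (auto simp: enn2real_positive_iff)
  show thesis
  proof (rule that)
    show "0 < 2 * \<rho> * enn2real T" using \<rho> Tp by simp
    fix k
    have "ennreal (2 * \<rho> * enn2real T * \<rho> ^ (2 * k)) = ennreal (2 * \<rho> ^ (2 * k + 1)) * T"
      using \<rho> by (subst Tr) (simp add: ennreal_mult'[symmetric] mult_ac)
    also have "\<dots> = (\<integral>\<^sup>+t. ennreal (2 * \<rho> ^ (2 * k + 1)) * (ennreal (g t) * indicator {\<rho>..<1} t) \<partial>lborel)"
      unfolding T_def by (intro nn_integral_cmult[symmetric]) measurable
    also have "\<dots> \<le> ennreal (moment \<omega> k)"
      unfolding moment_profile[OF \<omega> g]
    proof (intro nn_integral_mono)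
      fix r
      show "ennreal (2 * \<rho> ^ (2 * k + 1)) * (ennreal (g r) * indicator {\<rho>..<1} r) \<le>
          ennreal (2 * r ^ (2 * k + 1)) * ennreal (g r) * indicator {0..<1} r"
      proof (cases "r \<in> {\<rho>..<1}")
        case True
        then have "2 * \<rho> ^ (2 * k + 1) \<le> 2 * r ^ (2 * k + 1)"
          using \<rho> by (intro mult_left_mono power_mono) auto
        from mult_right_mono[OF ennreal_leI[OF this], of "ennreal (g r)"] True \<rho>
        show ?thesis by (auto split: split_indicator)
      qed auto
    qed
    finally show "2 * \<rho> * enn2real T * \<rho> ^ (2 * k) \<le> moment \<omega> k"
      by (subst (asm) ennreal_le_iff)
         (auto simp: moment_def intro!: integral_nonneg_AE AE_I2 mult_nonneg_nonneg radial_weight_nonneg[OF \<omega>])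
  qed
qed

lemma moment_pos:
  assumes "radial_weight \<omega>"
  shows "0 < moment \<omega> k"
proof -
  obtain c where "0 < c" "c * (1 / 2) ^ (2 * k) \<le> moment \<omega> k"
    using moment_lower_bound[OF assms, of "1 / 2"] by auto
  then show ?thesis by (smt (verit) mult_pos_pos zero_less_power half_gt_zero_iff)
qed

section \<open>The weight \<open>mu_weight\<close>\<close>

text \<open>
  The profile of \<open>mu_weight n \<omega>\<close> if \<open>g\<close> is that of \<open>\<omega>\<close>, with its true, possibly infinite, value at
  the origin.
\<close>

definition mu_profile :: "nat \<Rightarrow> (real \<Rightarrow> real) \<Rightarrow> real \<Rightarrow> ennreal" where
  "mu_profile n g s = ennreal (2 / fact (n - 1)) * shell (\<lambda>t. g t / t ^ (2 * n - 1)) (n - 1) s"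

lemma measurable_mu_profile [measurable]:
  assumes [measurable]: "g \<in> borel_measurable borel"
  shows "mu_profile n g \<in> borel_measurable borel"
  unfolding mu_profile_def[abs_def] by measurable

lemma profile_quotient_tail_finite:
  assumes \<omega>: "radial_weight \<omega>" "is_profile \<omega> g" and s: "0 < s"
  shows "(\<integral>\<^sup>+t\<in>{s..<1}. ennreal (g t / t ^ k) \<partial>lborel) < \<infinity>"
proof -
  note [measurable] = profile_measurable[OF \<omega>(2)]
  have g: "0 \<le> g t" for t by (rule profile_nonneg[OF \<omega>(2)])
  have "(\<integral>\<^sup>+t\<in>{s..<1}. ennreal (g t / t ^ k) \<partial>lborel) \<le>
      (\<integral>\<^sup>+t. ennreal (1 / s ^ k) * (ennreal (g t) * indicator {s..<1} t) \<partial>lborel)"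
  proof (intro nn_integral_mono)
    fix t
    have "g t / t ^ k \<le> 1 / s ^ k * g t" if "s \<le> t"
    proof -
      have "s ^ k \<le> t ^ k" using that s by (intro power_mono) auto
      then show ?thesis using s g[of t] that by (simp add: divide_left_mono)
    qed
    then show "ennreal (g t / t ^ k) * indicator {s..<1} t \<le> ennreal (1 / s ^ k) * (ennreal (g t) * indicator {s..<1} t)"
      using s g by (auto intro!: ennreal_leI simp: ennreal_mult'[symmetric] split: split_indicator)
  qed
  also have "\<dots> = ennreal (1 / s ^ k) * profile_tail g s"
    by (intro nn_integral_cmult) measurable
  also have "\<dots> < \<infinity>"
    using profile_tail_finite[OF \<omega> s] by (simp add: ennreal_mult_less_top)
  finally show ?thesis .
qed

lemma mu_profile_finite:
  assumes \<omega>: "radial_weight \<omega>" "is_profile \<omega> g" and s: "0 < s"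
  shows "mu_profile n g s < \<infinity>"
proof -
  have "shell (\<lambda>t. g t / t ^ (2 * n - 1)) (n - 1) s < \<infinity>"
    using s profile_nonneg[OF \<omega>(2)] by (intro shell_finite profile_quotient_tail_finite[OF \<omega>]) auto
  then show ?thesis by (simp add: mu_profile_def ennreal_mult_less_top)
qed

lemma nested_profile:
  assumes \<omega>: "is_profile \<omega> g" and "0 \<le> s"
  shows "nested (\<lambda>r. \<omega> (complex_of_real r) / r ^ k) m s = nested (\<lambda>r. g r / r ^ k) m s"
proof (rule nested_cong_AE[OF _ _ \<open>0 \<le> s\<close>])
  note [measurable] = profile_measurable[OF \<omega>]
  show "(\<lambda>r. g r / r ^ k) \<in> borel_measurable borel" by measurable
  have "AE r in lborel. r \<in> {0..<1} \<longrightarrow> \<omega> (complex_of_real r) / r ^ k = g r / r ^ k"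
    using profile_AE[OF \<omega>] by eventually_elim simp
  then show "AE r in lebesgue. r \<in> {0..<1} \<longrightarrow> \<omega> (complex_of_real r) / r ^ k = g r / r ^ k"
    by (rule AE_completion)
qed

lemma mu_weight_profile:
  assumes \<omega>: "radial_weight \<omega>" "is_profile \<omega> g" and n: "1 \<le> n"
  shows "mu_weight n \<omega> z = enn2real (mu_profile n g (norm z))"
proof -
  note [measurable] = profile_measurable[OF \<omega>(2)]
  have "mu_weight n \<omega> z = 2 ^ n * nested (\<lambda>r. g r / r ^ (2 * n - 1)) (n - 1) (norm z)"
    unfolding mu_weight_def using nested_profile[OF \<omega>(2)] by simp
  also have "nested (\<lambda>r. g r / r ^ (2 * n - 1)) (n - 1) (norm z) =
      enn2real (shell (\<lambda>r. g r / r ^ (2 * n - 1)) (n - 1) (norm z)) / (2 ^ (n - 1) * fact (n - 1))"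
    using profile_nonneg[OF \<omega>(2)] by (intro nested_eq_shell profile_quotient_tail_finite[OF \<omega>]) auto
  also have "(2::real) ^ n = 2 * 2 ^ (n - 1)" using n by (simp add: power_eq_if)
  finally show ?thesis by (simp add: mu_profile_def enn2real_mult)
qed

text \<open>
  Almost everywhere on \<open>[s, 1)\<close> the integrand is positive where \<open>g\<close> is, so it cannot vanish unless the
  tail of \<open>\<omega>\<close> does.
\<close>

lemma mu_profile_pos:
  assumes \<omega>: "radial_weight \<omega>" "is_profile \<omega> g" and s: "0 \<le> s" "s < 1"
  shows "0 < mu_profile n g s"
proof -
  note [measurable] = profile_measurable[OF \<omega>(2)]
  have g: "0 \<le> g t" for t by (rule profile_nonneg[OF \<omega>(2)])
  have "shell (\<lambda>t. g t / t ^ (2 * n - 1)) (n - 1) s \<noteq> 0"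
  proof
    assume "shell (\<lambda>t. g t / t ^ (2 * n - 1)) (n - 1) s = 0"
    then have "AE t in lborel. ennreal (g t / t ^ (2 * n - 1) * (t\<^sup>2 - s\<^sup>2) ^ (n - 1)) * indicator {s..<1} t = 0"
      unfolding shell_def by (subst (asm) nn_integral_0_iff_AE) auto
    then have "AE t in lborel. ennreal (g t) * indicator {s..<1} t = 0"
      using AE_lborel_singleton[of s] AE_lborel_singleton[of "0::real"]
    proof eventually_elim
      case (elim t)
      show ?case
      proof (cases "t \<in> {s..<1}")
        case True
        then have t: "s < t" "0 < t" using elim s by auto
        then have "s\<^sup>2 < t\<^sup>2" using s by (intro power_strict_mono) auto
        then have "0 < (t\<^sup>2 - s\<^sup>2) ^ (n - 1)" "0 < t ^ (2 * n - 1)" using t by auto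
        moreover have "g t / t ^ (2 * n - 1) * (t\<^sup>2 - s\<^sup>2) ^ (n - 1) \<le> 0"
          using elim True by (simp add: ennreal_eq_0_iff)
        ultimately have "g t \<le> 0"
          by (meson divide_pos_pos linorder_not_less mult_pos_pos)
        then show ?thesis by (simp add: ennreal_eq_0_iff)
      qed auto
    qed
    then have "profile_tail g s = 0"
      by (subst nn_integral_0_iff_AE) auto
    moreover have "0 < tail \<omega> (complex_of_real s)"
      using s by (intro radial_weight_tail_pos[OF \<omega>(1)]) auto
    ultimately show False using s by (simp add: tail_eq_profile[OF \<omega>(2)])
  qed
  then show ?thesis by (simp add: mu_profile_def zero_less_iff_neq_zero)
qed

text \<open>
  Interchanging the integrals leaves the beta integral over \<open>s\<close>; its value is a
  multiple of \<open>t^(2k + 2n)\<close>, which cancels the singular factor \<open>t^(1 - 2n)\<close> up to \<open>t^(2k + 1)\<close>.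
\<close>

lemma nn_integral_mu_profile_moment:
  assumes \<omega>: "is_profile \<omega> g" and n: "1 \<le> n"
  shows "(\<integral>\<^sup>+s\<in>{0..<1}. ennreal (2 * s ^ (2 * k + 1)) * mu_profile n g s \<partial>lborel) =
    ennreal (fact k / fact (k + n)) * (\<integral>\<^sup>+t\<in>{0..<1}. ennreal (2 * t ^ (2 * k + 1)) * ennreal (g t) \<partial>lborel)"
proof -
  note [measurable] = profile_measurable[OF \<omega>]
  have g: "0 \<le> g t" for t by (rule profile_nonneg[OF \<omega>])
  obtain m where m: "n = Suc m" using n by (cases n) auto
  define f where "f = (\<lambda>s t. ennreal (2 * s ^ (2 * k + 1)) * (ennreal (2 / fact m) * ennreal (g t / t ^ (2 * m + 1) * (t\<^sup>2 - s\<^sup>2) ^ m)))"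
  have [measurable]: "case_prod f \<in> borel_measurable (borel \<Otimes>\<^sub>M borel)" unfolding f_def by measurable
  have "(\<integral>\<^sup>+s\<in>{0..<1}. ennreal (2 * s ^ (2 * k + 1)) * mu_profile n g s \<partial>lborel) =
      (\<integral>\<^sup>+s\<in>{0..<1}. (\<integral>\<^sup>+t\<in>{s..<1}. f s t \<partial>lborel) \<partial>lborel)"
    unfolding mu_profile_def shell_def f_def m
    by (simp add: nn_integral_cmult[symmetric] mult.assoc)
  also have "\<dots> = (\<integral>\<^sup>+t\<in>{0..<1}. (\<integral>\<^sup>+s\<in>{0..t}. f s t \<partial>lborel) \<partial>lborel)"
    by (rule nn_integral_tail_Tonelli) measurable
  also have "\<dots> = (\<integral>\<^sup>+t. ennreal (fact k / fact (k + n)) * (ennreal (2 * t ^ (2 * k + 1)) * ennreal (g t) * indicator {0..<1} t) \<partial>lborel)"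
    using AE_lborel_singleton[of "0::real"]
  proof (intro nn_integral_cong_AE, eventually_elim)
    case (elim t)
    show ?case
    proof (cases "t \<in> {0..<1}")
      case True
      then have t: "0 < t" "t < 1" using elim by auto
      have "(\<integral>\<^sup>+s\<in>{0..t}. f s t \<partial>lborel) =
         (\<integral>\<^sup>+s. ennreal (2 / fact m * (g t / t ^ (2 * m + 1))) * (ennreal (2 * s ^ (2 * k + 1) * (t\<^sup>2 - s\<^sup>2) ^ m) * indicator {0..t} s) \<partial>lborel)"
        using t g unfolding f_def
        by (intro nn_integral_cong) (auto simp: ennreal_mult'[symmetric] mult_ac split: split_indicator)
      also have "\<dots> = ennreal (2 / fact m * (g t / t ^ (2 * m + 1))) *
           (\<integral>\<^sup>+s\<in>{0..t}. ennreal (2 * s ^ (2 * k + 1) * (t\<^sup>2 - s\<^sup>2) ^ m) \<partial>lborel)"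
        by (intro nn_integral_cmult) measurable
      also have "\<dots> = ennreal (2 / fact m * (g t / t ^ (2 * m + 1))) *
           ennreal (t ^ (2 * (k + m + 1)) * (fact k * fact m / fact (k + m + 1)))"
        using t by (subst beta_integral) auto
      also have "\<dots> = ennreal (2 / fact m * (g t / t ^ (2 * m + 1)) * (t ^ (2 * (k + m + 1)) * (fact k * fact m / fact (k + m + 1))))"
        using t g by (intro ennreal_mult'[symmetric]) auto
      also have "2 / fact m * (g t / t ^ (2 * m + 1)) * (t ^ (2 * (k + m + 1)) * (fact k * fact m / fact (k + m + 1))) =
          fact k / fact (k + n) * (2 * t ^ (2 * k + 1) * g t)"
      proof -
        have "2 * (k + m + 1) = (2 * k + 1) + (2 * m + 1)" by simp
        then have "t ^ (2 * (k + m + 1)) = t ^ (2 * k + 1) * t ^ (2 * m + 1)" by (metis power_add)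
        then show ?thesis using t by (simp add: m)
      qed
      finally show ?thesis using True t g by (simp add: ennreal_mult'[symmetric])
    qed auto
  qed
  also have "\<dots> = ennreal (fact k / fact (k + n)) * (\<integral>\<^sup>+t\<in>{0..<1}. ennreal (2 * t ^ (2 * k + 1)) * ennreal (g t) \<partial>lborel)"
    by (intro nn_integral_cmult) measurable
  finally show ?thesis .
qed

lemma is_profile_mu_weight:
  assumes \<omega>: "radial_weight \<omega>" "is_profile \<omega> g" and n: "1 \<le> n"
  shows "is_profile (mu_weight n \<omega>) (\<lambda>s. enn2real (mu_profile n g s))"
proof -
  note [measurable] = profile_measurable[OF \<omega>(2)]
  show ?thesis unfolding is_profile_def mu_weight_profile[OF \<omega> n] by (intro conjI allI AE_I2) auto
qed

text \<open>
  The possibly infinite value of \<open>mu_profile\<close> at the origin is invisible to integrals.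
\<close>

lemma nn_integral_enn2real_mu_profile:
  assumes \<omega>: "radial_weight \<omega>" "is_profile \<omega> g" and n: "1 \<le> n"
    and u: "\<And>s. s \<le> 0 \<Longrightarrow> u s = 0"
  shows "(\<integral>\<^sup>+s. u s * ennreal (enn2real (mu_profile n g s)) \<partial>lborel) = (\<integral>\<^sup>+s. u s * mu_profile n g s \<partial>lborel)"
proof (intro nn_integral_cong)
  fix s
  show "u s * ennreal (enn2real (mu_profile n g s)) = u s * mu_profile n g s"
    using mu_profile_finite[OF \<omega>, of s n] u[of s] by (cases "0 < s") auto
qed

lemma radial_weight_mu_weight:
  assumes \<omega>: "radial_weight \<omega>" and n: "1 \<le> n"
  shows "radial_weight (mu_weight n \<omega>)"
proof -
  obtain g where g: "is_profile \<omega> g" using radial_weight_profile[OF \<omega>] .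
  note [measurable] = profile_measurable[OF g] borel_measurable_norm_disc
  note mu = mu_weight_profile[OF \<omega> g n]
  show ?thesis
    unfolding radial_weight_def
  proof (intro conjI ballI)
    show "0 \<le> mu_weight n \<omega> z" for z by (simp add: mu)
    show "mu_weight n \<omega> z = mu_weight n \<omega> (complex_of_real (norm z))" for z by (simp add: mu)
    show "integrable disc_area (mu_weight n \<omega>)"
    proof (rule integrableI_nonneg)
      have m: "(\<lambda>s. enn2real (mu_profile n g s)) \<in> borel_measurable borel" by measurable
      show "mu_weight n \<omega> \<in> borel_measurable disc_area"
        unfolding mu by (intro borel_measurable_disc_areaI) measurable
      show "AE z in disc_area. 0 \<le> mu_weight n \<omega> z" by (simp add: mu)
      have "(\<integral>\<^sup>+z. ennreal (mu_weight n \<omega> z) \<partial>disc_area) =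
          (\<integral>\<^sup>+s\<in>{0..<1}. ennreal (2 * s) * ennreal (enn2real (mu_profile n g s)) \<partial>lborel)"
        unfolding mu by (rule nn_integral_disc_area_radial) measurable
      also have "\<dots> = (\<integral>\<^sup>+s. ennreal (2 * s) * indicator {0..<1} s * ennreal (enn2real (mu_profile n g s)) \<partial>lborel)"
        by (simp add: mult_ac)
      also have "\<dots> = (\<integral>\<^sup>+s. ennreal (2 * s) * indicator {0..<1} s * mu_profile n g s \<partial>lborel)"
        by (rule nn_integral_enn2real_mu_profile[OF \<omega> g n]) (auto simp: ennreal_neg)
      also have "\<dots> = (\<integral>\<^sup>+s\<in>{0..<1}. ennreal (2 * s ^ (2 * 0 + 1)) * mu_profile n g s \<partial>lborel)"
        by (simp add: mult_ac)
      also have "\<dots> = ennreal (fact 0 / fact (0 + n)) * ennreal (moment \<omega> 0)"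
        unfolding nn_integral_mu_profile_moment[OF g n] moment_profile[OF \<omega> g] ..
      also have "\<dots> < \<infinity>" by (simp add: ennreal_mult'[symmetric])
      finally show "(\<integral>\<^sup>+z. ennreal (mu_weight n \<omega> z) \<partial>disc_area) < \<infinity>" .
    qed
    fix z :: complex assume z: "z \<in> unit_disc"
    have "tail (mu_weight n \<omega>) z \<noteq> 0"
    proof
      assume "tail (mu_weight n \<omega>) z = 0"
      then have "(\<integral>\<^sup>+s\<in>{norm z..<1}. ennreal (enn2real (mu_profile n g s)) \<partial>lborel) = 0"
        by (simp add: tail_eq_profile[OF is_profile_mu_weight[OF \<omega> g n]])
      then have "AE s in lborel. ennreal (enn2real (mu_profile n g s)) * indicator {norm z..<1} s = 0"
        by (subst (asm) nn_integral_0_iff_AE) auto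
      then have "AE s in lborel. s \<notin> {norm z..<1}"
        using AE_lborel_singleton[of "0::real"]
      proof eventually_elim
        case (elim s)
        show ?case
        proof
          assume s: "s \<in> {norm z..<1}"
          then have "0 < s" "s < 1" using elim order_trans[OF norm_ge_zero, of z s] by auto
          then have "0 < mu_profile n g s" "mu_profile n g s < \<infinity>"
            using mu_profile_pos[OF \<omega> g, of s n] mu_profile_finite[OF \<omega> g, of s n] by auto
          then show False using elim s by auto
        qed
      qed
      then have "emeasure lborel {norm z..<1} = 0"
        by (subst (asm) AE_iff_null_sets[symmetric]) auto
      then show False using z by simp
    qed
    then show "0 < tail (mu_weight n \<omega>) z" by (simp add: zero_less_iff_neq_zero)
  qed
qed

text \<open>
  The identity for which \<open>mu_weight\<close> is designed: the ratio of the moments of \<open>\<omega>\<close> and of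
  \<open>mu_weight n \<omega>\<close> is \<open>(k + 1) \<cdots> (k + n)\<close>.
\<close>

lemma moment_mu_weight:
  assumes \<omega>: "radial_weight \<omega>" and n: "1 \<le> n"
  shows "moment (mu_weight n \<omega>) k = fact k / fact (k + n) * moment \<omega> k"
proof -
  obtain g where g: "is_profile \<omega> g" using radial_weight_profile[OF \<omega>] .
  have "ennreal (moment (mu_weight n \<omega>) k) =
      (\<integral>\<^sup>+s. ennreal (2 * s ^ (2 * k + 1)) * indicator {0..<1} s * ennreal (enn2real (mu_profile n g s)) \<partial>lborel)"
    unfolding moment_profile[OF radial_weight_mu_weight[OF \<omega> n] is_profile_mu_weight[OF \<omega> g n]]
    by (simp add: mult_ac)
  also have "\<dots> = (\<integral>\<^sup>+s. ennreal (2 * s ^ (2 * k + 1)) * indicator {0..<1} s * mu_profile n g s \<partial>lborel)"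
    by (rule nn_integral_enn2real_mu_profile[OF \<omega> g n]) (auto split: split_indicator)
  also have "\<dots> = (\<integral>\<^sup>+s\<in>{0..<1}. ennreal (2 * s ^ (2 * k + 1)) * mu_profile n g s \<partial>lborel)"
    by (simp add: mult_ac)
  also have "\<dots> = ennreal (fact k / fact (k + n)) * ennreal (moment \<omega> k)"
    unfolding nn_integral_mu_profile_moment[OF g n] moment_profile[OF \<omega> g] ..
  also have "\<dots> = ennreal (fact k / fact (k + n) * moment \<omega> k)"
    by (intro ennreal_mult'[symmetric]) auto
  finally show ?thesis
    using moment_pos[OF \<omega>, of k] moment_pos[OF radial_weight_mu_weight[OF \<omega> n], of k]
    by (subst (asm) ennreal_inj) (auto intro!: divide_nonneg_nonneg mult_nonneg_nonneg)
qed

section \<open>Power series in weighted Bergman spaces\<close>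

lemma disc_power_series:
  assumes "f holomorphic_on unit_disc"
  obtains a where "\<And>z. z \<in> unit_disc \<Longrightarrow> (\<lambda>k. a k * z ^ k) sums f z"
  using holomorphic_power_series[OF assms] that[of "\<lambda>k. (deriv ^^ k) f 0 / fact k"] by simp

lemma holomorphic_measurable_disc:
  assumes "f holomorphic_on unit_disc"
  shows "f \<in> borel_measurable disc_area"
  unfolding measurable_disc_area
  by (intro continuous_imp_measurable_on_sets_lebesgue holomorphic_on_imp_continuous_on[OF assms]) auto

lemma bergman_space_1_iff:
  "f \<in> bergman_space 1 \<omega> \<longleftrightarrow> f holomorphic_on unit_disc \<and> integrable disc_area (\<lambda>z. norm (f z) * \<omega> z)"
  by (simp add: bergman_space_def)

text \<open>
  A radial weight has finite total mass, so \<open>|f| \<le> 1 + |f|\<^sup>2\<close> suffices.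
\<close>

lemma bergman_space_2_subset_1:
  assumes \<omega>: "radial_weight \<omega>"
  shows "bergman_space 2 \<omega> \<subseteq> bergman_space 1 \<omega>"
proof
  fix f assume f: "f \<in> bergman_space 2 \<omega>"
  then have hol: "f holomorphic_on unit_disc" and int: "integrable disc_area (\<lambda>z. norm (f z) powr 2 * \<omega> z)"
    by (auto simp: bergman_space_def)
  note [measurable] = holomorphic_measurable_disc[OF hol] borel_measurable_integrable[OF radial_weight_integrable[OF \<omega>]]
  have "integrable disc_area (\<lambda>z. norm (f z) * \<omega> z)"
  proof (rule Bochner_Integration.integrable_bound)
    show "integrable disc_area (\<lambda>z. norm (f z) powr 2 * \<omega> z + \<omega> z)"
      by (intro Bochner_Integration.integrable_add int radial_weight_integrable[OF \<omega>])
    show "AE z in disc_area. norm (norm (f z) * \<omega> z) \<le> norm (norm (f z) powr 2 * \<omega> z + \<omega> z)"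
    proof (rule AE_I2)
      fix z assume "z \<in> space disc_area"
      then have w: "0 \<le> \<omega> z" using radial_weight_nonneg[OF \<omega>] by simp
      have "2 * norm (f z) \<le> 1 + norm (f z) * norm (f z)"
        using zero_le_power2[of "norm (f z) - 1"] by (simp add: power2_eq_square algebra_simps)
      then have "norm (f z) \<le> norm (f z) * norm (f z) + 1"
        using norm_ge_zero[of "f z"] by linarith
      then have "norm (f z) \<le> norm (f z) powr 2 + 1"
        by (simp add: powr_numeral power2_eq_square)
      from mult_right_mono[OF this w] w
      show "norm (norm (f z) * \<omega> z) \<le> norm (norm (f z) powr 2 * \<omega> z + \<omega> z)"
        by (simp add: algebra_simps)
    qed
  qed measurable
  then show "f \<in> bergman_space 1 \<omega>" using hol by (simp add: bergman_space_1_iff)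
qed

lemma bounded_holomorphic_in_bergman_space:
  assumes \<omega>: "radial_weight \<omega>" and hol: "f holomorphic_on unit_disc"
    and B: "\<And>z. z \<in> unit_disc \<Longrightarrow> norm (f z) \<le> B"
  shows "f \<in> bergman_space 2 \<omega>"
proof -
  note [measurable] = holomorphic_measurable_disc[OF hol] borel_measurable_integrable[OF radial_weight_integrable[OF \<omega>]]
  have "integrable disc_area (\<lambda>z. norm (f z) powr 2 * \<omega> z)"
  proof (rule Bochner_Integration.integrable_bound)
    show "integrable disc_area (\<lambda>z. B powr 2 * \<omega> z)"
      by (intro integrable_mult_right radial_weight_integrable[OF \<omega>])
    show "AE z in disc_area. norm (norm (f z) powr 2 * \<omega> z) \<le> norm (B powr 2 * \<omega> z)"
    proof (rule AE_I2)
      fix z assume "z \<in> space disc_area"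
      then have z: "z \<in> unit_disc" by simp
      have "norm (f z) powr 2 \<le> B powr 2" using B[OF z] by (intro powr_mono2) auto
      from mult_right_mono[OF this radial_weight_nonneg[OF \<omega> z]] radial_weight_nonneg[OF \<omega> z]
      show "norm (norm (f z) powr 2 * \<omega> z) \<le> norm (B powr 2 * \<omega> z)" by simp
    qed
  qed measurable
  then show ?thesis using hol by (simp add: bergman_space_def)
qed

text \<open>
  A rotation by a suitable angle changes the sign of the integrand and preserves the integral.
\<close>

lemma monomials_orthogonal:
  fixes w :: "complex \<Rightarrow> real"
  assumes rad: "\<And>z. z \<in> unit_disc \<Longrightarrow> w z = w (complex_of_real (norm z))"
    and w[measurable]: "w \<in> borel_measurable disc_area" and jk: "j \<noteq> k"
  shows "(LINT z|disc_area. z ^ j * cnj (z ^ k) * complex_of_real (w z)) = 0"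
proof -
  \<comment> \<open>rotation by \<open>\<theta>\<close> multiplies the integrand by \<open>cis ((j - k) \<theta>)\<close>, here \<open>cis pi = -1\<close>\<close>
  define c where "c = cis (pi / (real j - real k))"
  have c: "norm c = 1" by (simp add: c_def)
  have cc: "c ^ j * cnj c ^ k = -1"
  proof -
    have "c ^ j * cnj c ^ k = cis (real j * (pi / (real j - real k)) + real k * - (pi / (real j - real k)))"
      unfolding c_def cis_cnj by (simp only: Complex.DeMoivre cis_mult)
    also have "real j * (pi / (real j - real k)) + real k * - (pi / (real j - real k)) =
        (real j - real k) * (pi / (real j - real k))"
      by (simp add: left_diff_distrib diff_divide_distrib)
    also have "\<dots> = pi" using jk by simp
    finally show ?thesis by simp
  qed
  have id[measurable]: "(\<lambda>z. z) \<in> borel_measurable disc_area" by (intro borel_measurable_disc_areaI) simp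
  have [measurable]: "cnj \<in> borel_measurable borel"
    by (intro borel_measurable_continuous_onI continuous_intros)
  define h where "h = (\<lambda>z. z ^ j * cnj (z ^ k) * complex_of_real (w z))"
  have "(LINT z|disc_area. h z) = (LINT z|disc_area. h (c * z))"
    unfolding h_def by (rule integral_disc_area_rotate[OF c, symmetric]) measurable
  also have "\<dots> = (LINT z|disc_area. - h z)"
  proof (rule Bochner_Integration.integral_cong)
    fix z assume "z \<in> space disc_area"
    then have "w (c * z) = w z" using rad[of z] rad[of "c * z"] c by (simp add: norm_mult)
    then have "h (c * z) = (c ^ j * cnj c ^ k) * h z"
      by (simp add: h_def power_mult_distrib mult_ac)
    then show "h (c * z) = - h z" by (simp add: cc)
  qed simp
  finally show ?thesis by (simp add: h_def)
qed

text \<open>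
  On a disc of radius \<open>r < 1\<close> the power series converges uniformly, so it may be integrated
  termwise; orthogonality leaves the \<open>k\<close>-th term.
\<close>

lemma integral_mult_cnj_power_cutoff:
  assumes \<omega>: "radial_weight \<omega>" and a: "\<And>z. z \<in> unit_disc \<Longrightarrow> (\<lambda>k. a k * z ^ k) sums f z"
    and r: "0 < r" "r < 1"
  shows "(LINT z|disc_area. f z * cnj (z ^ k) * complex_of_real (indicator (ball 0 r) z * \<omega> z)) =
    a k * complex_of_real (LINT z|disc_area. norm z ^ (2 * k) * (indicator (ball 0 r) z * \<omega> z))"
proof -
  define w where "w = (\<lambda>z. indicator (ball 0 r) z * \<omega> z)"
  have ind[measurable]: "indicat_real (ball 0 r) \<in> borel_measurable disc_area"
    by (intro borel_measurable_disc_areaI borel_measurable_indicator) simp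
  note wm[measurable] = borel_measurable_integrable[OF radial_weight_integrable[OF \<omega>]] borel_measurable_norm_disc
  have id[measurable]: "(\<lambda>z. z) \<in> borel_measurable disc_area" by (intro borel_measurable_disc_areaI) simp
  have [measurable]: "cnj \<in> borel_measurable borel"
    by (intro borel_measurable_continuous_onI continuous_intros)
  have w[measurable]: "w \<in> borel_measurable disc_area" unfolding w_def by measurable
  have wr: "w z = w (complex_of_real (norm z))" if "z \<in> unit_disc" for z
    using radial_weight_radial[OF \<omega> that] by (simp add: w_def indicator_def)
  define F where "F = (\<lambda>j z. a j * z ^ j * cnj (z ^ k) * complex_of_real (w z))"
  have [measurable]: "F j \<in> borel_measurable disc_area" for j unfolding F_def by measurable
  have bound: "norm (F j z) \<le> norm (a j * complex_of_real r ^ j) * \<omega> z" if "z \<in> unit_disc" for j z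
  proof (cases "norm z < r")
    case True
    have "norm z ^ j * norm z ^ k \<le> r ^ j * 1"
      using True that r by (intro mult_mono power_mono power_le_one) auto
    then have "norm (a j) * (norm z ^ j * norm z ^ k) * \<omega> z \<le> norm (a j) * r ^ j * \<omega> z"
      using radial_weight_nonneg[OF \<omega> that] by (intro mult_right_mono mult_left_mono) auto
    then show ?thesis using True r radial_weight_nonneg[OF \<omega> that]
      by (simp add: F_def w_def norm_mult norm_power mult_ac)
  qed (use radial_weight_nonneg[OF \<omega> that] in \<open>auto simp: F_def w_def\<close>)
  have summ: "summable (\<lambda>j. norm (a j * complex_of_real r ^ j))"
  proof (rule powser_insidea)
    \<comment> \<open>absolute convergence at \<open>r\<close> from convergence at a point between \<open>r\<close> and \<open>1\<close>\<close>
    show "summable (\<lambda>j. a j * complex_of_real ((1 + r) / 2) ^ j)"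
      using r by (intro sums_summable[OF a]) (simp del: of_real_add of_real_divide)
    show "norm (complex_of_real r) < norm (complex_of_real ((1 + r) / 2))"
      using r by (simp del: of_real_add of_real_divide)
  qed
  have int: "integrable disc_area (F j)" for j
  proof (rule Bochner_Integration.integrable_bound)
    show "integrable disc_area (\<lambda>z. norm (a j * complex_of_real r ^ j) * \<omega> z)"
      by (intro integrable_mult_right radial_weight_integrable[OF \<omega>])
    show "AE z in disc_area. norm (F j z) \<le> norm (norm (a j * complex_of_real r ^ j) * \<omega> z)"
      using bound radial_weight_nonneg[OF \<omega>] by (intro AE_I2) (auto simp: abs_mult)
  qed measurable
  have "(\<lambda>j. integral\<^sup>L disc_area (F j)) sums (LINT z|disc_area. (\<Sum>j. F j z))"
  proof (rule sums_integral[OF int])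
    show "AE z in disc_area. summable (\<lambda>j. norm (F j z))"
    proof (rule AE_I2)
      fix z assume "z \<in> space disc_area"
      then show "summable (\<lambda>j. norm (F j z))"
        using bound by (intro summable_comparison_test'[OF summable_mult2[OF summ, of "\<omega> z"], of 0]) auto
    qed
    show "summable (\<lambda>j. LINT z|disc_area. norm (F j z))"
    proof (rule summable_comparison_test'[OF summable_mult2[OF summ, of "LINT z|disc_area. \<omega> z"], of 0])
      fix j
      have "(LINT z|disc_area. norm (F j z)) \<le> (LINT z|disc_area. norm (a j * complex_of_real r ^ j) * \<omega> z)"
        using bound radial_weight_integrable[OF \<omega>] int by (intro integral_mono) auto
      then show "norm (LINT z|disc_area. norm (F j z)) \<le> norm (a j * complex_of_real r ^ j) * (LINT z|disc_area. \<omega> z)"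
        by simp
    qed
  qed
  moreover have "integral\<^sup>L disc_area (F j) = (if j = k then a k * complex_of_real (LINT z|disc_area. norm z ^ (2 * k) * w z) else 0)" for j
  proof (cases "j = k")
    case True
    have "F k z = a k * complex_of_real (norm z ^ (2 * k) * w z)" for z
    proof -
      have "z ^ k * cnj (z ^ k) = (z * cnj z) ^ k" by (simp add: power_mult_distrib)
      also have "\<dots> = complex_of_real (norm z ^ (2 * k))"
        by (simp only: complex_norm_square[symmetric] power_mult of_real_power)
      finally have "z ^ k * cnj (z ^ k) = complex_of_real (norm z ^ (2 * k))" .
      then show ?thesis by (simp add: F_def mult.assoc)
    qed
    then have "F k = (\<lambda>z. a k * complex_of_real (norm z ^ (2 * k) * w z))"
      by blast
    then have "integral\<^sup>L disc_area (F k) = (LINT z|disc_area. a k * complex_of_real (norm z ^ (2 * k) * w z))"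
      by (simp only:)
    then show ?thesis using True by (simp only: integral_mult_right_zero integral_complex_of_real) simp
  next
    case False
    have "integral\<^sup>L disc_area (F j) = a j * (LINT z|disc_area. z ^ j * cnj (z ^ k) * complex_of_real (w z))"
      unfolding F_def by (simp only: mult.assoc integral_mult_right_zero)
    then show ?thesis using monomials_orthogonal[OF wr w False] False by simp
  qed
  then have "(\<lambda>j. integral\<^sup>L disc_area (F j)) sums (a k * complex_of_real (LINT z|disc_area. norm z ^ (2 * k) * w z))"
    using sums_single[of k "\<lambda>j. a k * complex_of_real (LINT z|disc_area. norm z ^ (2 * k) * w z)"] by simp
  ultimately have "(LINT z|disc_area. (\<Sum>j. F j z)) = a k * complex_of_real (LINT z|disc_area. norm z ^ (2 * k) * w z)"
    by (rule sums_unique2)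
  moreover have "(LINT z|disc_area. (\<Sum>j. F j z)) = (LINT z|disc_area. f z * cnj (z ^ k) * complex_of_real (w z))"
  proof (rule Bochner_Integration.integral_cong)
    fix z assume "z \<in> space disc_area"
    then have "(\<lambda>j. F j z) sums (f z * cnj (z ^ k) * complex_of_real (w z))"
      unfolding F_def using a by (intro sums_mult2) auto
    then show "(\<Sum>j. F j z) = f z * cnj (z ^ k) * complex_of_real (w z)" by (rule sums_unique[symmetric])
  qed simp
  ultimately show ?thesis by (simp add: w_def)
qed

text \<open>
  The limit \<open>r \<rightarrow> 1\<close> of the preceding lemma, with \<open>|f| \<omega>\<close> as dominating function.
\<close>

lemma integral_mult_cnj_power:
  assumes \<omega>: "radial_weight \<omega>" and f: "f \<in> bergman_space 1 \<omega>"
    and a: "\<And>z. z \<in> unit_disc \<Longrightarrow> (\<lambda>k. a k * z ^ k) sums f z"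
  shows "(LINT z|disc_area. f z * cnj (z ^ k) * complex_of_real (\<omega> z)) = a k * complex_of_real (moment \<omega> k)"
proof -
  define r where "r = (\<lambda>i. 1 - 1 / (real i + 2))"
  have r: "0 < r i" "r i < 1" for i by (auto simp: r_def field_simps)
  have hol: "f holomorphic_on unit_disc" and int: "integrable disc_area (\<lambda>z. norm (f z) * \<omega> z)"
    using f by (auto simp: bergman_space_1_iff)
  note [measurable] = holomorphic_measurable_disc[OF hol] borel_measurable_norm_disc
    borel_measurable_integrable[OF radial_weight_integrable[OF \<omega>]]
  have ind[measurable]: "indicat_real (ball 0 s) \<in> borel_measurable disc_area" for s
    by (intro borel_measurable_disc_areaI borel_measurable_indicator) simp
  have id[measurable]: "(\<lambda>z. z) \<in> borel_measurable disc_area" by (intro borel_measurable_disc_areaI) simp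
  have [measurable]: "cnj \<in> borel_measurable borel"
    by (intro borel_measurable_continuous_onI continuous_intros)
  have lim: "(\<lambda>i. indicat_real (ball 0 (r i)) z) \<longlonglongrightarrow> 1" if "z \<in> unit_disc" for z
  proof (rule tendsto_eventually)
    have "r \<longlonglongrightarrow> 1" unfolding r_def by real_asymp
    then have "\<forall>\<^sub>F i in sequentially. norm z < r i" using that by (intro order_tendstoD(1)) auto
    then show "\<forall>\<^sub>F i in sequentially. indicat_real (ball 0 (r i)) z = 1" by eventually_elim simp
  qed
  have L: "(\<lambda>i. LINT z|disc_area. f z * cnj (z ^ k) * complex_of_real (indicator (ball 0 (r i)) z * \<omega> z))
      \<longlonglongrightarrow> (LINT z|disc_area. f z * cnj (z ^ k) * complex_of_real (1 * \<omega> z))"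
  proof (rule integral_dominated_convergence[OF _ _ int])
    show "AE z in disc_area. (\<lambda>i. f z * cnj (z ^ k) * complex_of_real (indicator (ball 0 (r i)) z * \<omega> z))
        \<longlonglongrightarrow> f z * cnj (z ^ k) * complex_of_real (1 * \<omega> z)"
      using lim by (intro AE_I2 tendsto_intros) auto
    show "AE z in disc_area. norm (f z * cnj (z ^ k) * complex_of_real (indicator (ball 0 (r i)) z * \<omega> z)) \<le> norm (f z) * \<omega> z" for i
    proof (rule AE_I2)
      fix z assume "z \<in> space disc_area"
      then have z: "z \<in> unit_disc" by simp
      have "norm z ^ k * (indicat_real (ball 0 (r i)) z * \<omega> z) \<le> 1 * (1 * \<omega> z)"
        using z radial_weight_nonneg[OF \<omega> z] by (intro mult_mono power_le_one) (auto split: split_indicator)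
      from mult_left_mono[OF this norm_ge_zero[of "f z"]] radial_weight_nonneg[OF \<omega> z]
      show "norm (f z * cnj (z ^ k) * complex_of_real (indicator (ball 0 (r i)) z * \<omega> z)) \<le> norm (f z) * \<omega> z"
        by (simp add: norm_mult norm_power abs_mult mult.assoc)
    qed
  qed measurable
  have R: "(\<lambda>i. LINT z|disc_area. norm z ^ (2 * k) * (indicator (ball 0 (r i)) z * \<omega> z))
      \<longlonglongrightarrow> (LINT z|disc_area. norm z ^ (2 * k) * (1 * \<omega> z))"
  proof (rule integral_dominated_convergence[OF _ _ radial_weight_integrable[OF \<omega>]])
    show "AE z in disc_area. (\<lambda>i. norm z ^ (2 * k) * (indicator (ball 0 (r i)) z * \<omega> z))
        \<longlonglongrightarrow> norm z ^ (2 * k) * (1 * \<omega> z)"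
      using lim by (intro AE_I2 tendsto_intros) auto
    show "AE z in disc_area. norm (norm z ^ (2 * k) * (indicator (ball 0 (r i)) z * \<omega> z)) \<le> \<omega> z" for i
    proof (rule AE_I2)
      fix z assume "z \<in> space disc_area"
      then have z: "z \<in> unit_disc" by simp
      have "norm z ^ (2 * k) * (indicat_real (ball 0 (r i)) z * \<omega> z) \<le> 1 * (1 * \<omega> z)"
        using z radial_weight_nonneg[OF \<omega> z] by (intro mult_mono power_le_one) (auto split: split_indicator)
      then show "norm (norm z ^ (2 * k) * (indicator (ball 0 (r i)) z * \<omega> z)) \<le> \<omega> z"
        using radial_weight_nonneg[OF \<omega> z] by (simp add: abs_mult)
    qed
  qed measurable
  have "(\<lambda>i. a k * complex_of_real (LINT z|disc_area. norm z ^ (2 * k) * (indicator (ball 0 (r i)) z * \<omega> z)))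
      \<longlonglongrightarrow> a k * complex_of_real (LINT z|disc_area. norm z ^ (2 * k) * (1 * \<omega> z))"
    by (intro tendsto_intros R)
  moreover have "(LINT z|disc_area. f z * cnj (z ^ k) * complex_of_real (indicator (ball 0 (r i)) z * \<omega> z)) =
      a k * complex_of_real (LINT z|disc_area. norm z ^ (2 * k) * (indicator (ball 0 (r i)) z * \<omega> z))" for i
    by (rule integral_mult_cnj_power_cutoff[OF \<omega> a r])
  ultimately show ?thesis using LIMSEQ_unique[OF L] by (simp add: moment_def)
qed

text \<open>
  Absolute summability of \<open>b\<close> makes the series of \<open>K\<close> converge uniformly on the whole disc, so
  it is the factor \<open>cnj K\<close> that is expanded here, the \<open>k\<close>-th term being
  dominated by \<open>|b\<^sub>k| |f| \<omega>\<close>.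
\<close>

lemma integral_mult_cnj_series:
  assumes \<omega>: "radial_weight \<omega>" and f: "f \<in> bergman_space 1 \<omega>"
    and a: "\<And>z. z \<in> unit_disc \<Longrightarrow> (\<lambda>k. a k * z ^ k) sums f z"
    and b: "\<And>z. z \<in> unit_disc \<Longrightarrow> (\<lambda>k. b k * z ^ k) sums K z" and sb: "summable (\<lambda>k. norm (b k))"
  shows "integrable disc_area (\<lambda>z. f z * cnj (K z) * complex_of_real (\<omega> z))"
    and "(\<lambda>k. a k * cnj (b k) * complex_of_real (moment \<omega> k)) sums
      (LINT z|disc_area. f z * cnj (K z) * complex_of_real (\<omega> z))"
proof -
  have hol: "f holomorphic_on unit_disc" and int: "integrable disc_area (\<lambda>z. norm (f z) * \<omega> z)"
    using f by (auto simp: bergman_space_1_iff)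
  note [measurable] = holomorphic_measurable_disc[OF hol] borel_measurable_norm_disc
    borel_measurable_integrable[OF radial_weight_integrable[OF \<omega>]]
  have id[measurable]: "(\<lambda>z. z) \<in> borel_measurable disc_area" by (intro borel_measurable_disc_areaI) simp
  have [measurable]: "cnj \<in> borel_measurable borel"
    by (intro borel_measurable_continuous_onI continuous_intros)
  define F where "F = (\<lambda>k z. f z * cnj (b k * z ^ k) * complex_of_real (\<omega> z))"
  have [measurable]: "F k \<in> borel_measurable disc_area" for k unfolding F_def by measurable
  have bound: "norm (F k z) \<le> norm (b k) * (norm (f z) * \<omega> z)" if z: "z \<in> unit_disc" for k z
  proof -
    have "norm z ^ k * (norm (f z) * \<omega> z) \<le> 1 * (norm (f z) * \<omega> z)"
      using z radial_weight_nonneg[OF \<omega> z] by (intro mult_right_mono power_le_one) auto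
    from mult_left_mono[OF this norm_ge_zero[of "b k"]] radial_weight_nonneg[OF \<omega> z]
    show ?thesis by (simp add: F_def norm_mult norm_power mult_ac)
  qed
  have intF: "integrable disc_area (F k)" for k
  proof (rule Bochner_Integration.integrable_bound)
    show "integrable disc_area (\<lambda>z. norm (b k) * (norm (f z) * \<omega> z))"
      by (intro integrable_mult_right int)
    show "AE z in disc_area. norm (F k z) \<le> norm (norm (b k) * (norm (f z) * \<omega> z))"
      using bound radial_weight_nonneg[OF \<omega>] by (intro AE_I2) (auto simp: abs_mult)
  qed measurable
  have s1: "AE z in disc_area. summable (\<lambda>k. norm (F k z))"
  proof (rule AE_I2)
    fix z assume "z \<in> space disc_area"
    then show "summable (\<lambda>k. norm (F k z))"
      using bound by (intro summable_comparison_test'[OF summable_mult2[OF sb, of "norm (f z) * \<omega> z"], of 0]) auto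
  qed
  have s2: "summable (\<lambda>k. LINT z|disc_area. norm (F k z))"
  proof (rule summable_comparison_test'[OF summable_mult2[OF sb, of "LINT z|disc_area. norm (f z) * \<omega> z"], of 0])
    fix k
    have "(LINT z|disc_area. norm (F k z)) \<le> (LINT z|disc_area. norm (b k) * (norm (f z) * \<omega> z))"
      using bound int intF by (intro integral_mono) auto
    then show "norm (LINT z|disc_area. norm (F k z)) \<le> norm (b k) * (LINT z|disc_area. norm (f z) * \<omega> z)"
      by simp
  qed
  have sumF: "(\<Sum>k. F k z) = f z * cnj (K z) * complex_of_real (\<omega> z)" if "z \<in> space disc_area" for z
  proof -
    have "(\<lambda>k. cnj (b k * z ^ k)) sums cnj (K z)"
      unfolding sums_cnj using b that by simp
    then have "(\<lambda>k. F k z) sums (f z * cnj (K z) * complex_of_real (\<omega> z))"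
      unfolding F_def by (intro sums_mult2 sums_mult)
    then show ?thesis by (rule sums_unique[symmetric])
  qed
  show "integrable disc_area (\<lambda>z. f z * cnj (K z) * complex_of_real (\<omega> z))"
    using integrable_suminf[OF intF s1 s2] sumF
    by (subst Bochner_Integration.integrable_cong[OF refl, of _ _ "\<lambda>z. \<Sum>k. F k z"]) auto
  have "(\<lambda>k. integral\<^sup>L disc_area (F k)) sums (LINT z|disc_area. (\<Sum>k. F k z))"
    by (rule sums_integral[OF intF s1 s2])
  moreover have "(LINT z|disc_area. (\<Sum>k. F k z)) = (LINT z|disc_area. f z * cnj (K z) * complex_of_real (\<omega> z))"
    by (intro Bochner_Integration.integral_cong sumF) auto
  moreover have "integral\<^sup>L disc_area (F k) = a k * cnj (b k) * complex_of_real (moment \<omega> k)" for k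
  proof -
    have "F k = (\<lambda>z. cnj (b k) * (f z * cnj (z ^ k) * complex_of_real (\<omega> z)))"
      by (auto simp: F_def mult_ac)
    then have "integral\<^sup>L disc_area (F k) = cnj (b k) * (LINT z|disc_area. f z * cnj (z ^ k) * complex_of_real (\<omega> z))"
      by (simp only: integral_mult_right_zero)
    also have "(LINT z|disc_area. f z * cnj (z ^ k) * complex_of_real (\<omega> z)) = a k * complex_of_real (moment \<omega> k)"
      by (rule integral_mult_cnj_power[OF \<omega> f a])
    finally show ?thesis by (simp only: mult_ac)
  qed
  ultimately show "(\<lambda>k. a k * cnj (b k) * complex_of_real (moment \<omega> k)) sums
      (LINT z|disc_area. f z * cnj (K z) * complex_of_real (\<omega> z))" by simp
qed

section \<open>The reproducing kernel\<close>

text \<open>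
  Taylor coefficients at the origin of the reproducing kernel at \<open>z\<close>.
\<close>

definition kernel_coeff :: "(complex \<Rightarrow> real) \<Rightarrow> complex \<Rightarrow> nat \<Rightarrow> complex" where
  "kernel_coeff \<omega> z k = cnj z ^ k / complex_of_real (moment \<omega> k)"

lemma summable_kernel_coeff:
  assumes \<omega>: "radial_weight \<omega>" and z: "z \<in> unit_disc"
  shows "summable (\<lambda>k. norm (kernel_coeff \<omega> z k))"
proof -
  \<comment> \<open>any \<open>\<rho> < 1\<close> with \<open>norm z < \<rho>\<^sup>2\<close> makes the comparison series geometric\<close>
  define \<rho> where "\<rho> = sqrt ((1 + norm z) / 2)"
  have "norm z < 1" using z by simp
  then have *: "(1 + norm z) / 2 < 1" by (simp add: divide_less_eq)
  have **: "0 < (1 + norm z) / 2"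
    using add_pos_nonneg[OF zero_less_one norm_ge_zero[of z]] by (rule half_gt_zero)
  have \<rho>: "0 < \<rho>" "\<rho> < 1"
    unfolding \<rho>_def by (simp_all only: real_sqrt_gt_0_iff real_sqrt_lt_1_iff * **)
  have \<rho>2: "\<rho>\<^sup>2 = (1 + norm z) / 2"
    unfolding \<rho>_def by (rule real_sqrt_pow2[OF less_imp_le[OF **]])
  obtain c where c: "0 < c" "\<And>k. c * \<rho> ^ (2 * k) \<le> moment \<omega> k"
    using moment_lower_bound[OF \<omega> \<rho>] by metis
  have lt: "norm z < \<rho>\<^sup>2" "0 < \<rho>\<^sup>2"
    using ** \<open>norm z < 1\<close> unfolding \<rho>2 by (simp_all only: less_divide_eq_numeral1 **)
  have "summable (\<lambda>k. (norm z / \<rho>\<^sup>2) ^ k / c)"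
    using lt by (intro summable_divide summable_geometric) simp
  then show ?thesis
  proof (rule summable_comparison_test'[of _ 0])
    fix k
    have "norm (kernel_coeff \<omega> z k) = norm z ^ k / moment \<omega> k"
      using moment_pos[OF \<omega>, of k] by (simp add: kernel_coeff_def norm_divide norm_power)
    also have "\<dots> \<le> norm z ^ k / (c * \<rho> ^ (2 * k))"
      using c \<rho> moment_pos[OF \<omega>, of k] by (intro divide_left_mono mult_pos_pos) auto
    also have "\<dots> = (norm z / \<rho>\<^sup>2) ^ k / c"
      by (simp add: power_divide power_mult)
    finally show "norm (norm (kernel_coeff \<omega> z k)) \<le> (norm z / \<rho>\<^sup>2) ^ k / c" by simp
  qed
qed

text \<open>
  The kernel series is bounded on the disc, so it belongs to the space, and integrating against it
  recovers the power series of \<open>f\<close> at \<open>z\<close>.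
\<close>

lemma ex_reproducing_kernel:
  assumes \<omega>: "radial_weight \<omega>" and z: "z \<in> unit_disc"
  shows "\<exists>K. is_reproducing_kernel \<omega> z K"
proof -
  define K where "K = (\<lambda>\<zeta>. \<Sum>k. kernel_coeff \<omega> z k * \<zeta> ^ k)"
  note sb = summable_kernel_coeff[OF \<omega> z]
  have le: "norm (kernel_coeff \<omega> z k * \<zeta> ^ k) \<le> norm (kernel_coeff \<omega> z k)" if "\<zeta> \<in> unit_disc" for \<zeta> k
    using that by (auto simp: norm_mult norm_power intro!: mult_left_le power_le_one)
  have sn: "summable (\<lambda>k. norm (kernel_coeff \<omega> z k * \<zeta> ^ k))" if "\<zeta> \<in> unit_disc" for \<zeta>
    using le[OF that] by (intro summable_comparison_test'[OF sb, of 0]) auto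
  have b: "(\<lambda>k. kernel_coeff \<omega> z k * \<zeta> ^ k) sums K \<zeta>" if "\<zeta> \<in> unit_disc" for \<zeta>
    unfolding K_def by (intro summable_sums summable_norm_cancel[OF sn[OF that]])
  have hol: "K holomorphic_on unit_disc"
    using b by (intro power_series_holomorphic[of 0 1 "kernel_coeff \<omega> z"]) simp
  have K2: "K \<in> bergman_space 2 \<omega>"
  proof (rule bounded_holomorphic_in_bergman_space[OF \<omega> hol])
    fix \<zeta> :: complex assume \<zeta>: "\<zeta> \<in> unit_disc"
    have "norm (K \<zeta>) \<le> (\<Sum>k. norm (kernel_coeff \<omega> z k * \<zeta> ^ k))"
      unfolding K_def by (rule summable_norm[OF sn[OF \<zeta>]])
    also have "\<dots> \<le> (\<Sum>k. norm (kernel_coeff \<omega> z k))"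
      by (intro suminf_le le \<zeta> sn sb)
    finally show "norm (K \<zeta>) \<le> (\<Sum>k. norm (kernel_coeff \<omega> z k))" .
  qed
  have "f z = (LINT \<zeta>|disc_area. f \<zeta> * cnj (K \<zeta>) * complex_of_real (\<omega> \<zeta>))" if f: "f \<in> bergman_space 2 \<omega>" for f
  proof -
    obtain a where a: "\<And>z. z \<in> unit_disc \<Longrightarrow> (\<lambda>k. a k * z ^ k) sums f z"
      using disc_power_series f unfolding bergman_space_def by blast
    have "f \<in> bergman_space 1 \<omega>" using f bergman_space_2_subset_1[OF \<omega>] by blast
    from integral_mult_cnj_series(2)[OF \<omega> this a b sb]
    have "(\<lambda>k. a k * cnj (kernel_coeff \<omega> z k) * complex_of_real (moment \<omega> k)) sums
      (LINT \<zeta>|disc_area. f \<zeta> * cnj (K \<zeta>) * complex_of_real (\<omega> \<zeta>))" .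
    moreover have "a k * cnj (kernel_coeff \<omega> z k) * complex_of_real (moment \<omega> k) = a k * z ^ k" for k
      using moment_pos[OF \<omega>, of k] by (simp add: kernel_coeff_def)
    ultimately show ?thesis using a[OF z] by (simp add: sums_unique2)
  qed
  then show ?thesis using K2 unfolding is_reproducing_kernel_def by blast
qed

text \<open>
  Reproducing the monomial \<open>\<zeta>^k\<close> determines the \<open>k\<close>-th Taylor coefficient of any reproducing kernel,
  so the choice made in the definition of \<open>bergman_kernel\<close> is immaterial on the disc.
\<close>

lemma bergman_kernel_power_series:
  assumes \<omega>: "radial_weight \<omega>" and z: "z \<in> unit_disc" and \<zeta>: "\<zeta> \<in> unit_disc"
  shows "(\<lambda>k. kernel_coeff \<omega> z k * \<zeta> ^ k) sums bergman_kernel \<omega> z \<zeta>"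
proof -
  define K where "K = bergman_kernel \<omega> z"
  have "is_reproducing_kernel \<omega> z K"
    unfolding K_def bergman_kernel_def by (rule someI_ex[OF ex_reproducing_kernel[OF \<omega> z]])
  then have K2: "K \<in> bergman_space 2 \<omega>"
    and rep: "\<And>f. f \<in> bergman_space 2 \<omega> \<Longrightarrow> f z = (LINT \<zeta>|disc_area. f \<zeta> * cnj (K \<zeta>) * complex_of_real (\<omega> \<zeta>))"
    unfolding is_reproducing_kernel_def by auto
  obtain b where b: "\<And>z. z \<in> unit_disc \<Longrightarrow> (\<lambda>k. b k * z ^ k) sums K z"
    using disc_power_series K2 unfolding bergman_space_def by blast
  have K1: "K \<in> bergman_space 1 \<omega>" using K2 bergman_space_2_subset_1[OF \<omega>] by blast
  have "b k = kernel_coeff \<omega> z k" for k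
  proof -
    have "(\<lambda>\<zeta>. \<zeta> ^ k) \<in> bergman_space 2 \<omega>"
      by (rule bounded_holomorphic_in_bergman_space[OF \<omega>, of _ 1])
         (auto intro!: holomorphic_intros power_le_one simp: norm_power)
    from rep[OF this] have "cnj (z ^ k) = cnj (LINT \<zeta>|disc_area. \<zeta> ^ k * cnj (K \<zeta>) * complex_of_real (\<omega> \<zeta>))"
      by simp
    also have "\<dots> = (LINT \<zeta>|disc_area. cnj (\<zeta> ^ k * cnj (K \<zeta>) * complex_of_real (\<omega> \<zeta>)))"
      by (rule Bochner_Integration.integral_cnj[symmetric])
    also have "\<dots> = (LINT \<zeta>|disc_area. K \<zeta> * cnj (\<zeta> ^ k) * complex_of_real (\<omega> \<zeta>))"
      by (simp add: mult_ac)
    also have "\<dots> = b k * complex_of_real (moment \<omega> k)"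
      by (rule integral_mult_cnj_power[OF \<omega> K1 b])
    finally show ?thesis using moment_pos[OF \<omega>, of k] by (simp add: kernel_coeff_def field_simps)
  qed
  then show ?thesis using b[OF \<zeta>] by (simp add: K_def)
qed

lemma higher_deriv_power_series:
  assumes "F holomorphic_on unit_disc"
    and "\<And>z. z \<in> unit_disc \<Longrightarrow> (\<lambda>k. c k * z ^ k) sums F z" and "z \<in> unit_disc"
  shows "(\<lambda>k. fact (k + m) / fact k * c (k + m) * z ^ k) sums (deriv ^^ m) F z"
  using assms(3)
proof (induction m arbitrary: z)
  case 0
  then show ?case using assms(2) by simp
next
  case (Suc m)
  have hol: "(deriv ^^ m) F holomorphic_on unit_disc"
    by (intro holomorphic_higher_deriv assms(1)) auto
  have "(\<lambda>k. diffs (\<lambda>k. fact (k + m) / fact k * c (k + m)) k * z ^ k) sums deriv ((deriv ^^ m) F) z"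
  proof (rule termdiffs_sums_strong[of 1])
    show "((deriv ^^ m) F has_field_derivative deriv ((deriv ^^ m) F) z) (at z)"
      using Suc.prems by (intro holomorphic_derivI[OF hol]) auto
  qed (use Suc in auto)
  moreover have "diffs (\<lambda>k. fact (k + m) / fact k * c (k + m)) k = fact (k + Suc m) / fact k * c (k + Suc m)" for k
  proof -
    have "(fact (Suc k) :: complex) = of_nat (Suc k) * fact k" by (rule fact_Suc)
    moreover have "(of_nat (Suc k) :: complex) \<noteq> 0" by (simp only: of_nat_eq_0_iff)
    ultimately show ?thesis by (simp add: diffs_def del: of_nat_Suc fact_Suc)
  qed
  ultimately show ?case by simp
qed

text \<open>
  Integrated against \<open>f \<nu>\<close>, the kernel series multiplies the term \<open>a k * z ^ k\<close> by the quotient of the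
  moments of \<open>\<nu>\<close> and of \<open>mu_weight n \<nu>\<close>, which is the factor that differentiating
  \<open>a k * z ^ (k + n)\<close> \<open>n\<close> times produces.
\<close>

lemma has_bochner_integral_kernel_mu_weight:
  assumes \<nu>: "radial_weight \<nu>" and n: "1 \<le> n" and f: "f \<in> bergman_space 1 \<nu>" and z: "z \<in> unit_disc"
  shows "has_bochner_integral disc_area
      (\<lambda>\<zeta>. f \<zeta> * cnj (bergman_kernel (mu_weight n \<nu>) z \<zeta>) * complex_of_real (\<nu> \<zeta>))
      ((deriv ^^ n) (\<lambda>w. w ^ n * f w) z)"
proof -
  define \<mu> where "\<mu> = mu_weight n \<nu>"
  have \<mu>: "radial_weight \<mu>" unfolding \<mu>_def by (rule radial_weight_mu_weight[OF \<nu> n])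
  have hol: "f holomorphic_on unit_disc" using f by (simp add: bergman_space_def)
  obtain a where a: "\<And>z. z \<in> unit_disc \<Longrightarrow> (\<lambda>k. a k * z ^ k) sums f z"
    using disc_power_series hol by blast
  note series = integral_mult_cnj_series[OF \<nu> f a bergman_kernel_power_series[OF \<mu> z] summable_kernel_coeff[OF \<mu> z]]
  \<comment> \<open>Taylor coefficients of \<open>w ^ n * f w\<close>\<close>
  define c where "c = (\<lambda>k. if k < n then 0 else a (k - n))"
  have "(\<lambda>k. c k * w ^ k) sums (w ^ n * f w)" if w: "w \<in> unit_disc" for w
  proof (rule iffD1[OF sums_zero_iff_shift[where n = n]])
    have "(\<lambda>k. w ^ n * (a k * w ^ k)) sums (w ^ n * f w)" by (intro sums_mult a w)
    then show "(\<lambda>k. c (k + n) * w ^ (k + n)) sums (w ^ n * f w)"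
      by (simp add: c_def power_add mult_ac)
    show "c i * w ^ i = 0" if "i < n" for i using that by (simp add: c_def)
  qed
  moreover have "(\<lambda>w. w ^ n * f w) holomorphic_on unit_disc"
    by (intro holomorphic_intros hol)
  ultimately
  have "(\<lambda>k. fact (k + n) / fact k * c (k + n) * z ^ k) sums (deriv ^^ n) (\<lambda>w. w ^ n * f w) z"
    using z by (intro higher_deriv_power_series) auto
  moreover have "fact (k + n) / fact k * c (k + n) * z ^ k =
      a k * cnj (kernel_coeff \<mu> z k) * complex_of_real (moment \<nu> k)" for k
    using moment_pos[OF \<nu>, of k]
    by (simp add: c_def kernel_coeff_def \<mu>_def moment_mu_weight[OF \<nu> n])
  ultimately have "(deriv ^^ n) (\<lambda>w. w ^ n * f w) z =
      (LINT \<zeta>|disc_area. f \<zeta> * cnj (bergman_kernel \<mu> z \<zeta>) * complex_of_real (\<nu> \<zeta>))"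
    using series(2) by (simp add: sums_unique2)
  then show ?thesis using series(1) by (simp add: has_bochner_integral_iff \<mu>_def)
qed

section \<open>The constants \<open>C\<^sub>j\<close>\<close>

text \<open>
  The closed form of the constants \<open>C\<^sub>j\<close>: the binomial coefficients of \<open>(t\<^sup>2 - s\<^sup>2)^(n-1)\<close> with the
  factor \<open>2 / (n-1)!\<close> of \<open>mu_profile\<close>.
\<close>

definition mu_coeff :: "nat \<Rightarrow> nat \<Rightarrow> real" where
  "mu_coeff n j = 2 / fact (n - 1) * ((-1) ^ (j - 1) * real (n - 1 choose (j - 1)))"

lemma coeff_identity_mu_coeff:
  assumes n: "1 \<le> n"
  shows "coeff_identity n (mu_coeff n) k"
proof -
  obtain m where m: "n = Suc m" using n by (cases n) auto
  have "(\<Sum>j=1..n. mu_coeff n j / (real k + real j)) =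
      (\<Sum>i\<le>m. 2 / fact m * ((-1) ^ i * real (m choose i) / (real k + 1 + real i)))"
    unfolding m One_nat_def sum.atLeast1_atMost_eq lessThan_Suc_atMost
    by (intro sum.cong refl) (simp add: mu_coeff_def algebra_simps)
  also have "\<dots> = 2 / fact m * (fact m / pochhammer (real k + 1) (Suc m))"
    unfolding sum_distrib_left[symmetric] by (subst alternating_binomial_sum) auto
  also have "pochhammer (real k + 1) (Suc m) = (\<Prod>j=1..n. (real k + real j))"
    unfolding m One_nat_def prod.atLeast1_atMost_eq pochhammer_prod
    by (intro prod.cong) (auto simp: algebra_simps)
  finally show ?thesis unfolding coeff_identity_def by simp
qed

lemma coeff_identity_unique:
  assumes "\<And>k. 1 \<le> k \<Longrightarrow> coeff_identity n C k" "\<And>k. 1 \<le> k \<Longrightarrow> coeff_identity n C' k" "j \<in> {1..n}"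
  shows "C j = C' j"
proof -
  have "C j - C' j = 0"
  proof (rule partial_fractions_unique[where n = n and D = "\<lambda>j. C j - C' j", OF _ assms(3)])
    fix k :: nat assume "1 \<le> k"
    then show "(\<Sum>j=1..n. (C j - C' j) / (real k + real j)) = 0"
      using assms(1,2)[of k] by (simp add: coeff_identity_def diff_divide_distrib sum_subtractf)
  qed
  then show ?thesis by simp
qed

text \<open>
  Binomial expansion of \<open>(t\<^sup>2 - s\<^sup>2)^(n-1)\<close> under the integral. At the origin, where the integrals may
  diverge, only the term \<open>j = 1\<close> survives, and both sides come from the same integral of
  \<open>\<omega>(t) / t\<close>.
\<close>

lemma mu_weight_eq_sum:
  assumes \<omega>: "radial_weight \<omega>" and n: "1 \<le> n"
  shows "mu_weight n \<omega> z = (\<Sum>j=1..n. mu_coeff n j * norm z ^ (2 * j - 2) *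
      (LINT t:{norm z..<1}|lebesgue. \<omega> (complex_of_real t) / t ^ (2 * j - 1)))"
proof -
  obtain m where m: "n = Suc m" using n by (cases n) auto
  obtain g where g: "is_profile \<omega> g" using radial_weight_profile[OF \<omega>] .
  note [measurable] = profile_measurable[OF g]
  have g0: "0 \<le> g t" for t by (rule profile_nonneg[OF g])
  define x where "x = norm z"
  have x: "0 \<le> x" by (simp add: x_def)
  define I where "I = (\<lambda>k. nested (\<lambda>r. g r / r ^ k) 0 x)"
  have I: "(LINT t:{norm z..<1}|lebesgue. \<omega> (complex_of_real t) / t ^ k) = I k" for k
    using nested_profile[OF g x, of k 0] by (simp add: I_def x_def)
  have I': "I k = (LINT t|lborel. indicator {x..<1} t * (g t / t ^ k))" for k
    unfolding I_def nested.simps set_lebesgue_integral_def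
    by (subst integral_completion) auto
  have "mu_weight n \<omega> z = 2 / fact m * enn2real (shell (\<lambda>t. g t / t ^ (2 * m + 1)) m x)"
    unfolding mu_weight_profile[OF \<omega> g n] mu_profile_def by (simp add: m enn2real_mult x_def)
  also have "enn2real (shell (\<lambda>t. g t / t ^ (2 * m + 1)) m x) =
      (\<Sum>i\<le>m. (-1) ^ i * real (m choose i) * (x ^ (2 * i) * I (2 * i + 1)))"
  proof (cases "x = 0")
    case True
    have "shell (\<lambda>t. g t / t ^ (2 * m + 1)) m x = shell (\<lambda>t. g t / t ^ 1) 0 x"
      unfolding shell_def using AE_lborel_singleton[of "0::real"]
    proof (intro nn_integral_cong_AE, eventually_elim)
      case (elim t)
      then show ?case using True by (simp add: power_mult)
    qed
    also have "enn2real \<dots> = I 1"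
      unfolding I_def using x g0 profile_quotient_tail_finite[OF \<omega> g, of _ 1]
      by (subst nested_eq_shell) auto
    also have "I 1 = (\<Sum>i\<in>{0}. (-1) ^ i * real (m choose i) * (x ^ (2 * i) * I (2 * i + 1)))" by simp
    also have "\<dots> = (\<Sum>i\<le>m. (-1) ^ i * real (m choose i) * (x ^ (2 * i) * I (2 * i + 1)))"
      by (rule sum.mono_neutral_left) (auto simp: True)
    finally show ?thesis .
  next
    case False
    then have x0: "0 < x" using x by simp
    have int: "integrable lborel (\<lambda>t. indicator {x..<1} t * (g t / t ^ k))" for k
    proof (rule integrableI_nonneg)
      show "AE t in lborel. 0 \<le> indicator {x..<1} t * (g t / t ^ k)"
        using x g0 by (auto split: split_indicator)
      have "(\<integral>\<^sup>+t. ennreal (indicator {x..<1} t * (g t / t ^ k)) \<partial>lborel) =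
          (\<integral>\<^sup>+t\<in>{x..<1}. ennreal (g t / t ^ k) \<partial>lborel)"
        by (intro nn_integral_cong) (auto split: split_indicator)
      then show "(\<integral>\<^sup>+t. ennreal (indicator {x..<1} t * (g t / t ^ k)) \<partial>lborel) < \<infinity>"
        using profile_quotient_tail_finite[OF \<omega> g x0] by simp
    qed measurable
    have nn: "0 \<le> g t / t ^ (2 * m + 1) * (t\<^sup>2 - x\<^sup>2) ^ m" if "x \<le> t" for t
      using that x g0 by (intro mult_nonneg_nonneg divide_nonneg_nonneg zero_le_power) (auto intro: power_mono)
    have "shell (\<lambda>t. g t / t ^ (2 * m + 1)) m x =
       (\<integral>\<^sup>+t. ennreal (indicator {x..<1} t * (g t / t ^ (2 * m + 1) * (t\<^sup>2 - x\<^sup>2) ^ m)) \<partial>lborel)"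
      unfolding shell_def by (intro nn_integral_cong) (auto split: split_indicator)
    then have "enn2real (shell (\<lambda>t. g t / t ^ (2 * m + 1)) m x) =
        (LINT t|lborel. indicator {x..<1} t * (g t / t ^ (2 * m + 1) * (t\<^sup>2 - x\<^sup>2) ^ m))"
      using nn by (subst integral_eq_nn_integral) (auto split: split_indicator)
    also have "\<dots> = (LINT t|lborel. (\<Sum>i\<le>m. (-1) ^ i * real (m choose i) * (x ^ (2 * i) *
        (indicator {x..<1} t * (g t / t ^ (2 * i + 1))))))"
    proof (intro Bochner_Integration.integral_cong refl)
      fix t
      show "indicator {x..<1} t * (g t / t ^ (2 * m + 1) * (t\<^sup>2 - x\<^sup>2) ^ m) =
        (\<Sum>i\<le>m. (-1) ^ i * real (m choose i) * (x ^ (2 * i) * (indicator {x..<1} t * (g t / t ^ (2 * i + 1)))))"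
      proof (cases "t \<in> {x..<1}")
        case True
        then have t: "t > 0" using x0 by auto
        have "g t / t ^ (2 * m + 1) * (t\<^sup>2 - x\<^sup>2) ^ m =
            (\<Sum>i\<le>m. g t / t ^ (2 * m + 1) * (real (m choose i) * (- (x\<^sup>2)) ^ i * (t\<^sup>2) ^ (m - i)))"
          using binomial_ring[of "- (x\<^sup>2)" "t\<^sup>2" m] by (simp add: sum_distrib_left)
        also have "\<dots> = (\<Sum>i\<le>m. (-1) ^ i * real (m choose i) * (x ^ (2 * i) * (g t / t ^ (2 * i + 1))))"
        proof (intro sum.cong refl)
          fix i assume "i \<in> {..m}"
          then have "2 * m + 1 = (2 * i + 1) + 2 * (m - i)" by simp
          then have 1: "t ^ (2 * m + 1) = t ^ (2 * i + 1) * (t\<^sup>2) ^ (m - i)"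
            by (metis power_add power_mult)
          have 2: "(- (x\<^sup>2)) ^ i = (-1) ^ i * x ^ (2 * i)"
            unfolding power_minus[of "x\<^sup>2"] by (simp add: power_mult)
          show "g t / t ^ (2 * m + 1) * (real (m choose i) * (- (x\<^sup>2)) ^ i * (t\<^sup>2) ^ (m - i)) =
              (-1) ^ i * real (m choose i) * (x ^ (2 * i) * (g t / t ^ (2 * i + 1)))"
            unfolding 1 2 using t by simp
        qed
        finally show ?thesis using True by simp
      qed auto
    qed
    also have "\<dots> = (\<Sum>i\<le>m. (-1) ^ i * real (m choose i) * (x ^ (2 * i) * I (2 * i + 1)))"
      unfolding I'
    proof (subst Bochner_Integration.integral_sum)
      show "integrable lborel (\<lambda>t. (-1) ^ i * real (m choose i) * (x ^ (2 * i) *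
          (indicator {x..<1} t * (g t / t ^ (2 * i + 1)))))" for i
        by (intro integrable_mult_right int)
    qed (simp only: integral_mult_right_zero)
    finally show ?thesis .
  qed
  also have "2 / fact m * (\<Sum>i\<le>m. (-1) ^ i * real (m choose i) * (x ^ (2 * i) * I (2 * i + 1))) =
     (\<Sum>j=1..n. mu_coeff n j * x ^ (2 * j - 2) * I (2 * j - 1))"
    unfolding m One_nat_def sum.atLeast1_atMost_eq lessThan_Suc_atMost sum_distrib_left
    by (intro sum.cong refl) (simp add: mu_coeff_def)
  finally show ?thesis unfolding I x_def .
qed

section \<open>Asymptotics for doubling weights\<close>

lemma comparable_onI:
  assumes "0 < K" "0 < L" and "\<And>z. z \<in> S \<Longrightarrow> a z \<le> ennreal K * b z"
    and "\<And>z. z \<in> S \<Longrightarrow> ennreal L * b z \<le> a z"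
  shows "comparable_on S a b"
  unfolding comparable_on_def
proof (intro exI[of _ "max K (1 / L)"] conjI ballI)
  define C where "C = max K (1 / L)"
  show "0 < max K (1 / L)" using assms by auto
  then have C: "0 < C" by (simp add: C_def)
  fix z assume z: "z \<in> S"
  have "ennreal (1 / C) * a z \<le> ennreal (1 / C) * (ennreal K * b z)"
    by (intro mult_left_mono assms z) auto
  also have "\<dots> = ennreal (K / C) * b z"
    using assms C by (simp add: mult.assoc[symmetric] ennreal_mult'[symmetric])
  also have "\<dots> \<le> ennreal 1 * b z"
    using C by (intro mult_right_mono ennreal_leI) (auto simp: C_def divide_simps)
  finally show "ennreal (1 / max K (1 / L)) * a z \<le> b z" by (simp add: C_def)
  have "b z = ennreal (1 / L) * (ennreal L * b z)"
    using assms by (simp add: mult.assoc[symmetric] ennreal_mult'[symmetric])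
  also have "\<dots> \<le> ennreal C * a z"
    by (intro mult_mono assms z ennreal_leI) (auto simp: C_def)
  finally show "b z \<le> ennreal (max K (1 / L)) * a z" by (simp add: C_def)
qed

text \<open>
  Uses \<open>t\<^sup>2 - s\<^sup>2 \<le> 2 (1 - s)\<close>. The factor \<open>t^(1 - 2n)\<close> makes the constant depend on the distance
  \<open>r0\<close> from the origin.
\<close>

lemma mu_profile_upper:
  assumes g: "is_profile \<omega> g" and n: "1 \<le> n" and r0: "0 < r0" "r0 \<le> s" "s < 1"
  shows "mu_profile n g s \<le> ennreal (2 / fact (n - 1) * 2 ^ (n - 1) / r0 ^ (2 * n - 1)) *
    (profile_tail g s * ennreal ((1 - s) ^ (n - 1)))"
proof -
  note [measurable] = profile_measurable[OF g]
  have g0: "0 \<le> g t" for t by (rule profile_nonneg[OF g])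
  define A where "A = 2 ^ (n - 1) / r0 ^ (2 * n - 1) * (1 - s) ^ (n - 1)"
  have A: "0 \<le> A" using r0 by (simp add: A_def)
  have "shell (\<lambda>t. g t / t ^ (2 * n - 1)) (n - 1) s \<le>
      (\<integral>\<^sup>+t. ennreal A * (ennreal (g t) * indicator {s..<1} t) \<partial>lborel)"
    unfolding shell_def
  proof (intro nn_integral_mono)
    fix t
    have "g t / t ^ (2 * n - 1) * (t\<^sup>2 - s\<^sup>2) ^ (n - 1) \<le> A * g t" if t: "s \<le> t" "t < 1"
    proof -
      have "r0 ^ (2 * n - 1) \<le> t ^ (2 * n - 1)" using r0 t by (intro power_mono) auto
      then have 1: "g t / t ^ (2 * n - 1) \<le> g t / r0 ^ (2 * n - 1)"
        using r0 t g0 by (intro divide_left_mono) auto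
      have "t\<^sup>2 - s\<^sup>2 = (t - s) * (t + s)" by (simp add: power2_eq_square algebra_simps)
      also have "\<dots> \<le> (1 - s) * 2" using r0 t by (intro mult_mono) auto
      finally have "(t\<^sup>2 - s\<^sup>2) ^ (n - 1) \<le> ((1 - s) * 2) ^ (n - 1)"
        using r0 t by (intro power_mono) (auto intro: power_mono)
      then have "g t / t ^ (2 * n - 1) * (t\<^sup>2 - s\<^sup>2) ^ (n - 1) \<le> g t / r0 ^ (2 * n - 1) * ((1 - s) * 2) ^ (n - 1)"
        using 1 r0 t g0 by (intro mult_mono) (auto intro!: zero_le_power power_mono)
      also have "\<dots> = A * g t" unfolding power_mult_distrib by (simp add: A_def)
      finally show ?thesis .
    qed
    then show "ennreal (g t / t ^ (2 * n - 1) * (t\<^sup>2 - s\<^sup>2) ^ (n - 1)) * indicator {s..<1} t \<le>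
        ennreal A * (ennreal (g t) * indicator {s..<1} t)"
      using A g0 by (auto intro!: ennreal_leI simp: ennreal_mult'[symmetric] split: split_indicator)
  qed
  also have "\<dots> = ennreal A * profile_tail g s"
    by (intro nn_integral_cmult) measurable
  finally have "mu_profile n g s \<le> ennreal (2 / fact (n - 1)) * (ennreal A * profile_tail g s)"
    unfolding mu_profile_def by (intro mult_left_mono) auto
  also have "\<dots> = ennreal (2 / fact (n - 1) * A) * profile_tail g s"
    by (simp only: ennreal_mult''[OF A] mult.assoc)
  also have "2 / fact (n - 1) * A = (2 / fact (n - 1) * 2 ^ (n - 1) / r0 ^ (2 * n - 1)) * (1 - s) ^ (n - 1)"
    by (simp add: A_def)
  also have "ennreal \<dots> = ennreal (2 / fact (n - 1) * 2 ^ (n - 1) / r0 ^ (2 * n - 1)) * ennreal ((1 - s) ^ (n - 1))"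
    using r0 by (intro ennreal_mult'') auto
  finally show ?thesis by (simp only: mult_ac)
qed

text \<open>
  Restricting to \<open>t \<ge> (1 + s) / 2\<close> gives \<open>t\<^sup>2 - s\<^sup>2 \<ge> (1 - s) / 2 \<cdot> t\<close>, and the powers of \<open>t \<le> 1\<close>
  left in the denominator only help.
\<close>

lemma mu_profile_lower:
  assumes g: "is_profile \<omega> g" and n: "1 \<le> n" and s: "0 \<le> s" "s < 1"
  shows "ennreal (2 / fact (n - 1) * ((1 - s) / 2) ^ (n - 1)) * profile_tail g ((1 + s) / 2)
    \<le> mu_profile n g s"
proof -
  note [measurable] = profile_measurable[OF g]
  have g0: "0 \<le> g t" for t by (rule profile_nonneg[OF g])
  define A where "A = ((1 - s) / 2) ^ (n - 1)"
  have A: "0 \<le> A" using s by (simp add: A_def)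
  have "ennreal A * profile_tail g ((1 + s) / 2) =
      (\<integral>\<^sup>+t. ennreal A * (ennreal (g t) * indicator {(1 + s) / 2..<1} t) \<partial>lborel)"
    by (intro nn_integral_cmult[symmetric]) measurable
  also have "\<dots> \<le> shell (\<lambda>t. g t / t ^ (2 * n - 1)) (n - 1) s"
    unfolding shell_def
  proof (intro nn_integral_mono)
    fix t
    have "A * g t \<le> g t / t ^ (2 * n - 1) * (t\<^sup>2 - s\<^sup>2) ^ (n - 1)" if t: "(1 + s) / 2 \<le> t" "t < 1"
    proof -
      have t0: "0 < t" "s \<le> t" using t s by auto
      have "(1 - s) / 2 * t \<le> (t - s) * (t + s)" using t s by (intro mult_mono) auto
      also have "\<dots> = t\<^sup>2 - s\<^sup>2" by (simp add: power2_eq_square algebra_simps)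
      finally have "((1 - s) / 2 * t) ^ (n - 1) \<le> (t\<^sup>2 - s\<^sup>2) ^ (n - 1)"
        using s t0 by (intro power_mono) auto
      then have 1: "A * t ^ (n - 1) \<le> (t\<^sup>2 - s\<^sup>2) ^ (n - 1)" unfolding A_def power_mult_distrib .
      have "t ^ (2 * n - 1) \<le> t ^ (n - 1)"
        using t0 t by (intro power_decreasing) auto
      then have "A * t ^ (2 * n - 1) \<le> A * t ^ (n - 1)" using A by (intro mult_left_mono)
      with 1 have "A * t ^ (2 * n - 1) \<le> (t\<^sup>2 - s\<^sup>2) ^ (n - 1)" by simp
      then have "A \<le> (t\<^sup>2 - s\<^sup>2) ^ (n - 1) / t ^ (2 * n - 1)" using t0 by (simp add: pos_le_divide_eq)
      from mult_right_mono[OF this g0[of t]] show ?thesis by (simp add: mult_ac)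
    qed
    moreover have "s \<le> t" if "(1 + s) / 2 \<le> t" using that s by auto
    ultimately show "ennreal A * (ennreal (g t) * indicator {(1 + s) / 2..<1} t) \<le>
        ennreal (g t / t ^ (2 * n - 1) * (t\<^sup>2 - s\<^sup>2) ^ (n - 1)) * indicator {s..<1} t"
      using A g0 by (auto intro!: ennreal_leI simp: ennreal_mult'[symmetric] split: split_indicator)
  qed
  finally have "ennreal (2 / fact (n - 1)) * (ennreal A * profile_tail g ((1 + s) / 2)) \<le> mu_profile n g s"
    unfolding mu_profile_def by (intro mult_left_mono) auto
  moreover have "ennreal (2 / fact (n - 1) * A) = ennreal (2 / fact (n - 1)) * ennreal A"
    using A by (rule ennreal_mult'')
  ultimately show ?thesis by (simp only: A_def mult.assoc)
qed

lemma tail_mu_weight_profile: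
  assumes \<omega>: "radial_weight \<omega>" "is_profile \<omega> g" and n: "1 \<le> n"
  shows "tail (mu_weight n \<omega>) z = (\<integral>\<^sup>+s\<in>{norm z..<1}. mu_profile n g s \<partial>lborel)"
proof -
  have "tail (mu_weight n \<omega>) z = (\<integral>\<^sup>+s\<in>{norm z..<1}. ennreal (enn2real (mu_profile n g s)) \<partial>lborel)"
    by (rule tail_eq_profile[OF is_profile_mu_weight[OF \<omega> n]])
  also have "\<dots> = (\<integral>\<^sup>+s\<in>{norm z..<1}. mu_profile n g s \<partial>lborel)"
    using AE_lborel_singleton[of "0::real"]
  proof (intro nn_integral_cong_AE, eventually_elim)
    case (elim s)
    show ?case
    proof (cases "s \<in> {norm z..<1}")
      case True
      then have "0 < s" using elim order_trans[OF norm_ge_zero, of z s] by auto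
      then show ?thesis using mu_profile_finite[OF \<omega>, of s n] by simp
    qed auto
  qed
  finally show ?thesis .
qed

text \<open>
  Unlike for \<open>mu_profile\<close> itself, the bound holds uniformly down to the origin. After interchanging
  the integrals, the one over \<open>s\<close> is at most \<open>2^(n-1) ((t - x) / t)^n\<close>, and \<open>(t - x) / t \<le> 1 - x\<close>.
\<close>

lemma tail_mu_profile_upper:
  assumes g: "is_profile \<omega> g" and n: "1 \<le> n" and x: "0 \<le> x" "x < 1"
  shows "(\<integral>\<^sup>+s\<in>{x..<1}. mu_profile n g s \<partial>lborel) \<le>
    ennreal (2 / fact (n - 1) * 2 ^ (n - 1)) * (profile_tail g x * ennreal ((1 - x) ^ n))"
proof -
  note [measurable] = profile_measurable[OF g]
  have g0: "0 \<le> g t" for t by (rule profile_nonneg[OF g])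
  obtain m where m: "n = Suc m" using n by (cases n) auto
  define k where "k = (\<lambda>s t. ennreal (g t / t ^ (2 * m + 1) * (t\<^sup>2 - s\<^sup>2) ^ m))"
  have [measurable]: "case_prod k \<in> borel_measurable (borel \<Otimes>\<^sub>M borel)" unfolding k_def by measurable
  have km: "(\<lambda>s. \<integral>\<^sup>+t\<in>{s..<1}. k s t \<partial>lborel) \<in> borel_measurable borel"
    by (rule measurable_tail_integral) measurable
  have "(\<integral>\<^sup>+s\<in>{x..<1}. mu_profile n g s \<partial>lborel) =
      (\<integral>\<^sup>+s. ennreal (2 / fact m) * ((\<integral>\<^sup>+t\<in>{s..<1}. k s t \<partial>lborel) * indicator {x..<1} s) \<partial>lborel)"
    by (simp add: mu_profile_def shell_def m k_def mult.assoc)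
  also have "\<dots> = ennreal (2 / fact m) * (\<integral>\<^sup>+s\<in>{x..<1}. (\<integral>\<^sup>+t\<in>{s..<1}. k s t \<partial>lborel) \<partial>lborel)"
    using km by (intro nn_integral_cmult borel_measurable_times_ennreal) auto
  also have "(\<integral>\<^sup>+s\<in>{x..<1}. (\<integral>\<^sup>+t\<in>{s..<1}. k s t \<partial>lborel) \<partial>lborel) =
      (\<integral>\<^sup>+t\<in>{x..<1}. (\<integral>\<^sup>+s\<in>{x..t}. k s t \<partial>lborel) \<partial>lborel)"
    by (rule nn_integral_tail_Tonelli) measurable
  also have "\<dots> \<le> (\<integral>\<^sup>+t. ennreal (2 ^ m * (1 - x) ^ n) * (ennreal (g t) * indicator {x..<1} t) \<partial>lborel)"
    using AE_lborel_singleton[of "0::real"]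
  proof (intro nn_integral_mono_AE, eventually_elim)
    case (elim t)
    show ?case
    proof (cases "t \<in> {x..<1}")
      case True
      then have t: "0 < t" "x \<le> t" "t < 1" using elim x by auto
      \<comment> \<open>bound for the integrand that is constant in \<open>s\<close>, from \<open>t\<^sup>2 - s\<^sup>2 \<le> (t - x) (2 t)\<close>\<close>
      define B where "B = g t * 2 ^ m * (t - x) ^ m / t ^ Suc m"
      have B: "0 \<le> B" using t g0 by (simp add: B_def)
      have "k s t \<le> ennreal B" if s: "x \<le> s" "s \<le> t" for s
      proof -
        have p: "t ^ (2 * m + 1) = t ^ m * t ^ Suc m" by (simp flip: power_add add: mult_2)
        have "t\<^sup>2 - s\<^sup>2 = (t - s) * (t + s)" by (simp add: power2_eq_square algebra_simps)
        also have "\<dots> \<le> (t - x) * (2 * t)" using s t x by (intro mult_mono) auto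
        finally have "(t\<^sup>2 - s\<^sup>2) ^ m \<le> ((t - x) * (2 * t)) ^ m"
          using s t x by (intro power_mono) (auto intro: power_mono)
        then have "g t / t ^ (2 * m + 1) * (t\<^sup>2 - s\<^sup>2) ^ m \<le> g t / t ^ (2 * m + 1) * ((t - x) * (2 * t)) ^ m"
          using t g0 by (intro mult_left_mono) auto
        also have "g t / t ^ (2 * m + 1) * ((t - x) * (2 * t)) ^ m = B"
          unfolding p using t by (simp add: B_def power_mult_distrib)
        finally show ?thesis unfolding k_def by (rule ennreal_leI)
      qed
      then have "(\<integral>\<^sup>+s\<in>{x..t}. k s t \<partial>lborel) \<le> (\<integral>\<^sup>+s. ennreal B * indicator {x..t} s \<partial>lborel)"
        by (intro nn_integral_mono) (auto split: split_indicator)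
      also have "\<dots> = ennreal (B * (t - x))"
        using t B by (simp add: nn_integral_cmult_indicator ennreal_mult')
      also have "B * (t - x) \<le> 2 ^ m * (1 - x) ^ n * g t"
      proof -
        have "(t - x) / t \<le> 1 - x" using t x by (simp add: divide_simps algebra_simps mult_left_le_one_le)
        then have "((t - x) / t) ^ n \<le> (1 - x) ^ n" using t by (intro power_mono) auto
        then have "g t * 2 ^ m * ((t - x) / t) ^ n \<le> g t * 2 ^ m * (1 - x) ^ n"
          using g0 by (intro mult_left_mono) auto
        moreover have "B * (t - x) = g t * 2 ^ m * ((t - x) / t) ^ n"
          by (simp add: B_def m power_divide)
        ultimately show ?thesis by (simp add: mult_ac)
      qed
      finally show ?thesis using True g0 x
        by (simp add: ennreal_mult'[symmetric] ennreal_leI)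
    qed auto
  qed
  also have "\<dots> = ennreal (2 ^ m * (1 - x) ^ n) * profile_tail g x"
    by (intro nn_integral_cmult) measurable
  finally have "(\<integral>\<^sup>+s\<in>{x..<1}. mu_profile n g s \<partial>lborel) \<le>
      ennreal (2 / fact m) * (ennreal (2 ^ m * (1 - x) ^ n) * profile_tail g x)"
    by (simp add: mult_left_mono)
  also have "ennreal (2 ^ m * (1 - x) ^ n) = ennreal (2 ^ m) * ennreal ((1 - x) ^ n)"
    by (intro ennreal_mult') auto
  also have "ennreal (2 / fact m) * (ennreal (2 ^ m) * ennreal ((1 - x) ^ n) * profile_tail g x) =
      (ennreal (2 / fact m) * ennreal (2 ^ m)) * (profile_tail g x * ennreal ((1 - x) ^ n))"
    by (simp only: mult_ac)
  also have "ennreal (2 / fact m) * ennreal (2 ^ m) = ennreal (2 / fact (n - 1) * 2 ^ (n - 1))"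
    unfolding m diff_Suc_1 by (rule ennreal_mult'[symmetric]) simp
  finally show ?thesis .
qed

lemma profile_tail_antimono:
  assumes "s \<le> s'"
  shows "profile_tail g s' \<le> profile_tail g s"
  using assms by (intro nn_integral_mono) (auto split: split_indicator)

text \<open>
  The doubling condition turns the tail from \<open>(1 + s) / 2\<close> in \<open>mu_profile_lower\<close> into the tail from
  \<open>s\<close>.
\<close>

lemma doubling_mu_profile_lower:
  assumes g: "is_profile \<omega> g" and n: "1 \<le> n" and s: "0 \<le> s" "s < 1" and D: "1 \<le> D"
    and dbl: "profile_tail g s \<le> ennreal D * profile_tail g ((1 + s) / 2)"
  shows "ennreal (2 / (fact (n - 1) * 2 ^ (n - 1) * D)) *
    (profile_tail g s * ennreal ((1 - s) ^ (n - 1))) \<le> mu_profile n g s"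
proof -
  define L where "L = 2 / (fact (n - 1) * 2 ^ (n - 1) * D)"
  have L: "0 \<le> L" using D by (simp add: L_def)
  have "ennreal L * (profile_tail g s * ennreal ((1 - s) ^ (n - 1))) \<le>
      ennreal L * ((ennreal D * profile_tail g ((1 + s) / 2)) * ennreal ((1 - s) ^ (n - 1)))"
    by (intro mult_left_mono mult_right_mono dbl) auto
  also have "\<dots> = ennreal L * ennreal D * ennreal ((1 - s) ^ (n - 1)) * profile_tail g ((1 + s) / 2)"
    by (simp only: mult_ac)
  also have "ennreal L * ennreal D * ennreal ((1 - s) ^ (n - 1)) = ennreal (L * D * (1 - s) ^ (n - 1))"
    using L D s by (simp add: ennreal_mult)
  also have "L * D * (1 - s) ^ (n - 1) = 2 / fact (n - 1) * ((1 - s) / 2) ^ (n - 1)"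
    using D by (simp add: L_def power_divide)
  also have "ennreal \<dots> * profile_tail g ((1 + s) / 2) \<le> mu_profile n g s"
    by (rule mu_profile_lower[OF g n s])
  finally show ?thesis by (simp only: L_def)
qed

text \<open>
  On \<open>[x, (1 + x) / 2]\<close>, an interval of length \<open>(1 - x) / 2\<close>, the lower bound for \<open>mu_profile\<close> is at
  least its value with \<open>1 - s\<close> replaced by \<open>(1 - x) / 2\<close> and the tail by the one from \<open>(1 + x) / 2\<close>;
  doubling then compares this tail with the one from \<open>x\<close>.
\<close>

lemma tail_mu_profile_lower:
  assumes n: "1 \<le> n" and x: "0 \<le> x" "x < 1" and D: "1 \<le> D" and L: "0 < L"
    and dbl: "profile_tail g x \<le> ennreal D * profile_tail g ((1 + x) / 2)"
    and low: "\<And>s. 0 \<le> s \<Longrightarrow> s < 1 \<Longrightarrow>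
      ennreal L * (profile_tail g s * ennreal ((1 - s) ^ (n - 1))) \<le> mu_profile n g s"
  shows "ennreal (L / (2 ^ n * D)) * (profile_tail g x * ennreal ((1 - x) ^ n))
    \<le> (\<integral>\<^sup>+s\<in>{x..<1}. mu_profile n g s \<partial>lborel)"
proof -
  define T where "T = profile_tail g ((1 + x) / 2)"
  define v where "v = ennreal L * (T * ennreal (((1 - x) / 2) ^ (n - 1)))"
  have K: "0 \<le> L / (2 ^ n * D)" using L D by simp
  have pw: "((1 - x) / 2) ^ (n - 1) * ((1 - x) / 2) = ((1 - x) / 2) ^ n"
    using n by (cases n) auto
  have "ennreal (L / (2 ^ n * D)) * (profile_tail g x * ennreal ((1 - x) ^ n)) \<le>
      ennreal (L / (2 ^ n * D)) * ((ennreal D * T) * ennreal ((1 - x) ^ n))"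
    unfolding T_def by (intro mult_left_mono mult_right_mono dbl) auto
  also have "\<dots> = ennreal (L / (2 ^ n * D)) * ennreal D * ennreal ((1 - x) ^ n) * T"
    by (simp only: mult_ac)
  also have "ennreal (L / (2 ^ n * D)) * ennreal D * ennreal ((1 - x) ^ n) = ennreal (L / (2 ^ n * D) * D * (1 - x) ^ n)"
    using K D x by (simp only: ennreal_mult mult_nonneg_nonneg zero_le_power)
  also have "L / (2 ^ n * D) * D * (1 - x) ^ n = L * ((1 - x) / 2) ^ n"
    using D by (simp add: power_divide)
  also have "\<dots> = L * (((1 - x) / 2) ^ (n - 1) * ((1 - x) / 2))" by (simp only: pw)
  also have "ennreal \<dots> * T = v * ennreal ((1 - x) / 2)"
  proof -
    have q: "0 \<le> (1 - x) / 2" using x by simp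
    have "ennreal (L * (((1 - x) / 2) ^ (n - 1) * ((1 - x) / 2))) =
        ennreal L * (ennreal (((1 - x) / 2) ^ (n - 1)) * ennreal ((1 - x) / 2))"
      using less_imp_le[OF L] q zero_le_power[OF q] by (simp only: ennreal_mult mult_nonneg_nonneg)
    then show ?thesis by (simp only: v_def mult_ac)
  qed
  also have "\<dots> = v * emeasure lborel {x..(1 + x) / 2}"
    using x by (simp add: field_simps)
  also have "\<dots> = (\<integral>\<^sup>+s. v * indicator {x..(1 + x) / 2} s \<partial>lborel)"
    by (rule nn_integral_cmult_indicator[symmetric]) simp
  also have "\<dots> \<le> (\<integral>\<^sup>+s\<in>{x..<1}. mu_profile n g s \<partial>lborel)"
  proof (intro nn_integral_mono)
    fix s
    have "v \<le> mu_profile n g s" if s: "x \<le> s" "s \<le> (1 + x) / 2"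
    proof -
      have "((1 - x) / 2) ^ (n - 1) \<le> (1 - s) ^ (n - 1)"
        using s x by (intro power_mono) auto
      then have "v \<le> ennreal L * (profile_tail g s * ennreal ((1 - s) ^ (n - 1)))"
        unfolding v_def T_def using s
        by (intro mult_left_mono mult_mono profile_tail_antimono ennreal_leI) auto
      also have "\<dots> \<le> mu_profile n g s" using s x by (intro low) auto
      finally show ?thesis .
    qed
    then show "v * indicator {x..(1 + x) / 2} s \<le> mu_profile n g s * indicator {x..<1} s"
      using x by (auto split: split_indicator)
  qed
  finally show ?thesis .
qed

text \<open>
  Since \<open>(t\<^sup>2 - s\<^sup>2)^(n-1) \<le> t^(2n-2)\<close>, an integrable \<open>\<omega>(t) / t\<close> keeps \<open>mu_weight\<close> bounded near the
  origin.
\<close>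

lemma mu_profile_le_integral_quotient:
  assumes g: "is_profile \<omega> g" and n: "1 \<le> n" and s: "0 \<le> s"
  shows "mu_profile n g s \<le> ennreal (2 / fact (n - 1)) * (\<integral>\<^sup>+t\<in>{0..<1}. ennreal (g t / t) \<partial>lborel)"
  unfolding mu_profile_def shell_def
proof (intro mult_left_mono nn_integral_mono)
  fix t
  have g0: "0 \<le> g t" for t by (rule profile_nonneg[OF g])
  have "g t / t ^ (2 * n - 1) * (t\<^sup>2 - s\<^sup>2) ^ (n - 1) \<le> g t / t" if t: "s \<le> t"
  proof (cases "t = 0")
    case False
    then have t0: "0 < t" using s t by auto
    have "(t\<^sup>2 - s\<^sup>2) ^ (n - 1) \<le> (t\<^sup>2) ^ (n - 1)"
      using s t by (intro power_mono) (auto intro: power_mono)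
    then have "g t / t ^ (2 * n - 1) * (t\<^sup>2 - s\<^sup>2) ^ (n - 1) \<le> g t / t ^ (2 * n - 1) * (t\<^sup>2) ^ (n - 1)"
      using t0 g0 by (intro mult_left_mono) auto
    also have "\<dots> = g t / t"
    proof -
      have "2 * n - 1 = Suc (2 * (n - 1))" using n by simp
      then show ?thesis using t0 by (simp add: power_mult)
    qed
    finally show ?thesis .
  qed (use n in \<open>simp add: power_0_left\<close>)
  then show "ennreal (g t / t ^ (2 * n - 1) * (t\<^sup>2 - s\<^sup>2) ^ (n - 1)) * indicator {s..<1} t \<le>
      ennreal (g t / t) * indicator {0..<1} t"
    using s by (auto intro!: ennreal_leI split: split_indicator)
qed auto

text \<open>
  The lower estimate holds on the whole punctured disc. The upper one can fail near the origin, where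
  \<open>mu_weight\<close> is unbounded if \<open>\<nu>(t) / t\<close> is not integrable, and the default value \<open>0\<close> of a divergent
  integral then spoils the lower one at the origin itself; hence the three variants. Tails are not
  affected.
\<close>

lemma mu_weight_asymptotics:
  assumes \<nu>: "doubling_weight \<nu>" and n: "1 \<le> n"
  shows "0 < r0 \<Longrightarrow> r0 < 1 \<Longrightarrow> comparable_on {z. r0 \<le> norm z \<and> norm z < 1}
      (\<lambda>z. ennreal (mu_weight n \<nu> z)) (\<lambda>z. tail \<nu> z * ennreal ((1 - norm z) ^ (n - 1)))" (is "_ \<Longrightarrow> _ \<Longrightarrow> ?A")
    and "\<exists>c::real. 0 < c \<and> (\<forall>z\<in>unit_disc - {0}.
      ennreal c * (tail \<nu> z * ennreal ((1 - norm z) ^ (n - 1))) \<le> ennreal (mu_weight n \<nu> z))" (is ?B)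
    and "(\<integral>\<^sup>+ s\<in>{0..<1}. ennreal (\<nu> (complex_of_real s) / s) \<partial>lebesgue) < \<infinity> \<Longrightarrow>
      comparable_on unit_disc (\<lambda>z. ennreal (mu_weight n \<nu> z))
        (\<lambda>z. tail \<nu> z * ennreal ((1 - norm z) ^ (n - 1)))" (is "_ \<Longrightarrow> ?C")
    and "comparable_on unit_disc (tail (mu_weight n \<nu>)) (\<lambda>z. tail \<nu> z * ennreal ((1 - norm z) ^ n))" (is ?D)
proof -
  have rw: "radial_weight \<nu>" using \<nu> by (simp add: doubling_weight_def)
  obtain g where g: "is_profile \<nu> g" using radial_weight_profile[OF rw] .
  note tl = tail_eq_profile[OF g]
  define T where "T = profile_tail g"
  obtain D where D: "1 \<le> D" and dbl: "\<And>r. 0 \<le> r \<Longrightarrow> r < 1 \<Longrightarrow> T r \<le> ennreal D * T ((1 + r) / 2)"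
  proof -
    obtain D where "1 \<le> D" and *: "\<And>r::real. 0 \<le> r \<Longrightarrow> r < 1 \<Longrightarrow>
        tail \<nu> (complex_of_real r) \<le> ennreal D * tail \<nu> (complex_of_real ((1 + r) / 2))"
      using \<nu> unfolding doubling_weight_def by blast
    moreover have "tail \<nu> (complex_of_real r) = T r" if "0 \<le> r" for r
      using that by (simp add: tl T_def)
    ultimately show thesis
      by (intro that[of D]) (metis add_nonneg_nonneg divide_nonneg_pos zero_le_one zero_less_numeral)+
  qed
  define b where "b = (\<lambda>m z. tail \<nu> z * ennreal ((1 - norm z) ^ m))"
  define L where "L = 2 / (fact (n - 1) * 2 ^ (n - 1) * D)"
  have L: "0 < L" using D by (simp add: L_def)
  have low: "ennreal L * (T s * ennreal ((1 - s) ^ (n - 1))) \<le> mu_profile n g s" if "0 \<le> s" "s < 1" for s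
    unfolding L_def T_def using doubling_mu_profile_lower[OF g n that D] dbl[OF that] by (simp only: T_def)
  have mu: "ennreal (mu_weight n \<nu> z) = mu_profile n g (norm z)" if "mu_profile n g (norm z) < \<infinity>" for z :: complex
    using that by (simp add: mu_weight_profile[OF rw g n])
  have lower: "ennreal L * b (n - 1) z \<le> mu_profile n g (norm z)" if "norm z < 1" for z :: complex
    using low[of "norm z"] that by (simp add: b_def T_def tl)
  have upper: "mu_profile n g (norm z) \<le> ennreal (2 / fact (n - 1) * 2 ^ (n - 1) / r0 ^ (2 * n - 1)) * b (n - 1) z"
    if "0 < r0" "r0 \<le> norm z" "norm z < 1" for r0 and z :: complex
    using mu_profile_upper[OF g n that] by (simp add: b_def tl)
  show "?A" if r0: "0 < r0" "r0 < 1"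
  proof (rule comparable_onI)
    show "0 < 2 / fact (n - 1) * 2 ^ (n - 1) / r0 ^ (2 * n - 1)" using r0 by simp
    show "0 < L" by (rule L)
    fix z :: complex assume "z \<in> {z. r0 \<le> norm z \<and> norm z < 1}"
    then have z: "r0 \<le> norm z" "norm z < 1" by auto
    have eq: "ennreal (mu_weight n \<nu> z) = mu_profile n g (norm z)"
      using z r0 by (intro mu mu_profile_finite[OF rw g]) auto
    show "ennreal (mu_weight n \<nu> z) \<le> ennreal (2 / fact (n - 1) * 2 ^ (n - 1) / r0 ^ (2 * n - 1)) *
        (tail \<nu> z * ennreal ((1 - norm z) ^ (n - 1)))"
      using upper[OF r0(1) z] unfolding eq b_def .
    show "ennreal L * (tail \<nu> z * ennreal ((1 - norm z) ^ (n - 1))) \<le> ennreal (mu_weight n \<nu> z)"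
      using lower[OF z(2)] unfolding eq b_def .
  qed
  show ?B
  proof (intro exI[of _ L] conjI ballI L)
    fix z :: complex assume z: "z \<in> unit_disc - {0}"
    have eq: "ennreal (mu_weight n \<nu> z) = mu_profile n g (norm z)"
      using z by (intro mu mu_profile_finite[OF rw g]) auto
    show "ennreal L * (tail \<nu> z * ennreal ((1 - norm z) ^ (n - 1))) \<le> ennreal (mu_weight n \<nu> z)"
      using lower[of z] z unfolding eq b_def by simp
  qed
  show ?C if fin: "(\<integral>\<^sup>+ s\<in>{0..<1}. ennreal (\<nu> (complex_of_real s) / s) \<partial>lebesgue) < \<infinity>"
  proof -
    define A where "A = ennreal (2 / fact (n - 1)) * (\<integral>\<^sup>+t\<in>{0..<1}. ennreal (g t / t) \<partial>lborel)"
    have "(\<integral>\<^sup>+ s\<in>{0..<1}. ennreal (\<nu> (complex_of_real s) / s) \<partial>lebesgue) =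
        (\<integral>\<^sup>+ s\<in>{0..<1}. ennreal (\<nu> (complex_of_real s) / s) \<partial>lborel)"
      by (simp add: nn_integral_completion)
    also have "\<dots> = (\<integral>\<^sup>+t\<in>{0..<1}. ennreal (g t / t) \<partial>lborel)"
      using profile_AE[OF g] by (intro nn_integral_cong_AE, eventually_elim) (auto split: split_indicator)
    finally have A: "A < \<infinity>" using fin by (simp add: A_def ennreal_mult_less_top)
    \<comment> \<open>for \<open>norm z < 1 / 2\<close> the weight is at most \<open>\<alpha>\<close> and its comparison function at least \<open>\<beta>\<close>\<close>
    define B where "B = T (1 / 2) * ennreal ((1 / 2) ^ (n - 1))"
    have "0 < tail \<nu> (complex_of_real (1 / 2))"
      by (rule radial_weight_tail_pos[OF rw]) simp
    then have "0 < T (1 / 2)" by (simp add: tl T_def)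
    moreover have "T (1 / 2) < \<infinity>" unfolding T_def by (rule profile_tail_finite[OF rw g]) simp
    ultimately have B: "0 < B" "B < \<infinity>"
      by (auto simp: B_def ennreal_zero_less_mult_iff ennreal_mult_less_top)
    obtain \<alpha> where \<alpha>: "A = ennreal \<alpha>" "0 \<le> \<alpha>" using A by (cases A) auto
    obtain \<beta> where \<beta>: "B = ennreal \<beta>" "0 < \<beta>" using B by (cases B) auto
    define K where "K = max (2 / fact (n - 1) * 2 ^ (n - 1) / (1 / 2) ^ (2 * n - 1)) (\<alpha> / \<beta>)"
    have K: "0 < K" by (simp add: K_def less_max_iff_disj)
    show ?C
    proof (rule comparable_onI[OF K L])
      fix z :: complex assume "z \<in> unit_disc"
      then have z: "norm z < 1" by simp
      have leA: "mu_profile n g (norm z) \<le> A"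
        unfolding A_def by (rule mu_profile_le_integral_quotient[OF g n]) simp
      then have eq: "ennreal (mu_weight n \<nu> z) = mu_profile n g (norm z)"
        using A by (intro mu) (rule le_less_trans)
      show "ennreal (mu_weight n \<nu> z) \<le> ennreal K * (tail \<nu> z * ennreal ((1 - norm z) ^ (n - 1)))"
      proof (cases "1 / 2 \<le> norm z")
        case True
        have "mu_profile n g (norm z) \<le> ennreal (2 / fact (n - 1) * 2 ^ (n - 1) / (1 / 2) ^ (2 * n - 1)) * b (n - 1) z"
          by (rule upper[OF _ True z]) simp
        also have "\<dots> \<le> ennreal K * b (n - 1) z"
          by (intro mult_right_mono ennreal_leI) (auto simp: K_def)
        finally show ?thesis unfolding eq b_def .
      next
        case False
        have "B \<le> b (n - 1) z"
          unfolding B_def b_def tl T_def using False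
          by (intro mult_mono profile_tail_antimono ennreal_leI power_mono) auto
        have "A = ennreal (\<alpha> / \<beta>) * B"
          using \<alpha> \<beta> by (simp add: ennreal_mult'[symmetric])
        also have "\<dots> \<le> ennreal K * b (n - 1) z"
          by (intro mult_mono ennreal_leI \<open>B \<le> b (n - 1) z\<close>) (auto simp: K_def)
        finally have "A \<le> ennreal K * b (n - 1) z" .
        with leA show ?thesis unfolding eq b_def by (rule order_trans)
      qed
      show "ennreal L * (tail \<nu> z * ennreal ((1 - norm z) ^ (n - 1))) \<le> ennreal (mu_weight n \<nu> z)"
        using lower[OF z] unfolding eq b_def .
    qed
  qed
  show ?D
  proof (rule comparable_onI)
    show "0 < 2 / fact (n - 1) * (2::real) ^ (n - 1)" by simp
    show "0 < L / (2 ^ n * D)" using L D by simp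
    fix z :: complex assume "z \<in> unit_disc"
    then have z: "0 \<le> norm z" "norm z < 1" by auto
    show "tail (mu_weight n \<nu>) z \<le> ennreal (2 / fact (n - 1) * 2 ^ (n - 1)) * (tail \<nu> z * ennreal ((1 - norm z) ^ n))"
      unfolding tail_mu_weight_profile[OF rw g n] tl by (rule tail_mu_profile_upper[OF g n z])
    show "ennreal (L / (2 ^ n * D)) * (tail \<nu> z * ennreal ((1 - norm z) ^ n)) \<le> tail (mu_weight n \<nu>) z"
      unfolding tail_mu_weight_profile[OF rw g n] tl
      using dbl[OF z] low unfolding T_def by (intro tail_mu_profile_lower[OF n z D L])
  qed
qed

section \<open>The theorem\<close>

theorem lemma8:
  fixes \<nu> :: "complex \<Rightarrow> real" and n :: nat
  assumes "radial_weight \<nu>" and "1 \<le> n"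
  shows
    "(\<exists>C :: nat \<Rightarrow> real.
        (\<forall>k::nat. coeff_identity n C k) \<and>
        (\<forall>C' :: nat \<Rightarrow> real.
           (\<forall>k\<ge>1. coeff_identity n C' k) \<longrightarrow> (\<forall>j\<in>{1..n}. C' j = C j)) \<and>
        (\<forall>z\<in>unit_disc.
           mu_weight n \<nu> z =
             (\<Sum>j=1..n. C j * norm z ^ (2 * j - 2) *
                (LINT t:{norm z..<1}|lebesgue. \<nu> (complex_of_real t) / t ^ (2 * j - 1)))))
     \<and> (\<forall>f\<in>bergman_space 1 \<nu>. \<forall>z\<in>unit_disc.
          has_bochner_integral disc_area
            (\<lambda>\<zeta>. f \<zeta> * cnj (bergman_kernel (mu_weight n \<nu>) z \<zeta>) * complex_of_real (\<nu> \<zeta>))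
            ((deriv ^^ n) (\<lambda>w. w ^ n * f w) z))
     \<and> (doubling_weight \<nu> \<longrightarrow>
          (\<forall>r0::real. 0 < r0 \<and> r0 < 1 \<longrightarrow>
             comparable_on {z. r0 \<le> norm z \<and> norm z < 1}
               (\<lambda>z. ennreal (mu_weight n \<nu> z))
               (\<lambda>z. tail \<nu> z * ennreal ((1 - norm z) ^ (n - 1)))) \<and>
          (\<exists>c::real. 0 < c \<and> (\<forall>z\<in>unit_disc - {0}.
             ennreal c * (tail \<nu> z * ennreal ((1 - norm z) ^ (n - 1)))
               \<le> ennreal (mu_weight n \<nu> z))) \<and>
          ((\<integral>\<^sup>+ s\<in>{0..<1}. ennreal (\<nu> (complex_of_real s) / s) \<partial>lebesgue) < \<infinity> \<longrightarrow>
             comparable_on unit_disc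
               (\<lambda>z. ennreal (mu_weight n \<nu> z))
               (\<lambda>z. tail \<nu> z * ennreal ((1 - norm z) ^ (n - 1)))) \<and>
          comparable_on unit_disc
            (tail (mu_weight n \<nu>))
            (\<lambda>z. tail \<nu> z * ennreal ((1 - norm z) ^ n)))"
proof (intro conjI)
  note \<nu> = assms(1) and n = assms(2)
  show "\<exists>C :: nat \<Rightarrow> real.
        (\<forall>k::nat. coeff_identity n C k) \<and>
        (\<forall>C' :: nat \<Rightarrow> real.
           (\<forall>k\<ge>1. coeff_identity n C' k) \<longrightarrow> (\<forall>j\<in>{1..n}. C' j = C j)) \<and>
        (\<forall>z\<in>unit_disc.
           mu_weight n \<nu> z =
             (\<Sum>j=1..n. C j * norm z ^ (2 * j - 2) *
                (LINT t:{norm z..<1}|lebesgue. \<nu> (complex_of_real t) / t ^ (2 * j - 1))))"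
    using coeff_identity_mu_coeff[OF n] coeff_identity_unique[of n _ "mu_coeff n"] mu_weight_eq_sum[OF \<nu> n]
    by (intro exI[of _ "mu_coeff n"]) blast
  show "\<forall>f\<in>bergman_space 1 \<nu>. \<forall>z\<in>unit_disc.
          has_bochner_integral disc_area
            (\<lambda>\<zeta>. f \<zeta> * cnj (bergman_kernel (mu_weight n \<nu>) z \<zeta>) * complex_of_real (\<nu> \<zeta>))
            ((deriv ^^ n) (\<lambda>w. w ^ n * f w) z)"
    using has_bochner_integral_kernel_mu_weight[OF \<nu> n] by blast
qed (use mu_weight_asymptotics[OF _ assms(2)] in blast)

end
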